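(* Let $q$ be a prime power, and let $n$ range over the even positive integers. Let $Z_t$ and $Y_t^{(n)}$ be the processes defined in the context. Let $0<t_1<t_2<\cdots<t_k$ be a deterministic sequence of times. Assume that $Z_0$ is a (deterministic) constant in $\mathbb{Z}$, and that $Y_0^{(n)}=Z_0$ for all large enough $n$. Then $\left(Y_{t_1}^{(n)},Y_{t_2}^{(n)},\dots,Y_{t_k}^{(n)}\right)$ converges to $\left(Z_{t_1},Z_{t_2},\dots,Z_{t_k}\right)$ in total variation distance as $n\to\infty$.
   Context: $(a;q)_r=\prod_{i=0}^{r-1}(1-aq^i)$. $(X_i^{(n)})_{i\ge 0}$ is a discrete time Markov chain on $\{0,1,\dots,n\}$ with transition matrix $$P_n(d,r)=\mathbf{1}(d+r\le n)\,q^{-(n-d-r)(n-r)}\frac{(q^{-(n-d)};q)_r(q^{-n};q)_r}{(q^{-r};q)_r},$$ and for real $t\ge 0$, $Y^{(n)}_t=X^{(n)}_{2\lfloor q^{n/2}(q-1)t\rfloor}-n/2$. $(Z_t)_{t\ge 0}$ is the continuous time Markov chain on $\mathbb{Z}$ with transition rates $Q_Z(a,a+1)=q^{-a}$, $Q_Z(a,a-1)=q^{a}$, $Q_Z(a,a)=-q^a-q^{-a}$, and $Q_Z(a,b)=0$ otherwise (it has no explosions). *)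

theory Defs
  imports "HOL-Probability.Probability" "HOL-Number_Theory.Prime_Powers"
begin

definition q_poch :: "real \<Rightarrow> real \<Rightarrow> nat \<Rightarrow> real" where
  "q_poch a q r = (\<Prod>i<r. 1 - a * q ^ i)"

definition P_mat :: "nat \<Rightarrow> nat \<Rightarrow> nat \<Rightarrow> nat \<Rightarrow> real" where
  "P_mat q n d r =
     (if d + r \<le> n
      then real q powi (- ((int n - int d - int r) * (int n - int r)))
           * (q_poch (real q powi (- (int n - int d))) (real q) r
              * q_poch (real q powi (- int n)) (real q) r)
           / q_poch (real q powi (- int r)) (real q) r
      else 0)"

definition Q_Z :: "nat \<Rightarrow> int \<Rightarrow> int \<Rightarrow> real" where
  "Q_Z q a b =
     (if b = a + 1 then real q powi (- a)
      else if b = a - 1 then real q powi a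
      else if b = a then - (real q powi a) - real q powi (- a)
      else 0)"

text \<open>Time-homogeneous discrete-time Markov chain with state space \<open>S\<close> and transition matrix
  \<open>P\<close>; the initial law is arbitrary.\<close>

definition markov_chain ::
    "'a measure \<Rightarrow> 's set \<Rightarrow> ('s \<Rightarrow> 's \<Rightarrow> real) \<Rightarrow> (nat \<Rightarrow> 'a \<Rightarrow> 's) \<Rightarrow> bool" where
  "markov_chain M S P X \<longleftrightarrow>
     prob_space M \<and>
     (\<forall>i. X i \<in> measurable M (count_space S)) \<and>
     (\<forall>m x. (\<forall>i\<le>Suc m. x i \<in> S) \<and> measure M {\<omega> \<in> space M. \<forall>i\<le>m. X i \<omega> = x i} > 0 \<longrightarrow>
        cond_prob M (\<lambda>\<omega>. X (Suc m) \<omega> = x (Suc m)) (\<lambda>\<omega>. \<forall>i\<le>m. X i \<omega> = x i)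
          = P (x m) (x (Suc m)))"

text \<open>Honest transition functions: every row of \<open>p t\<close> has total mass one, so no mass escapes
  in finite time.\<close>

definition transition_function :: "(real \<Rightarrow> 's \<Rightarrow> 's \<Rightarrow> real) \<Rightarrow> bool" where
  "transition_function p \<longleftrightarrow>
     (\<forall>t\<ge>0. \<forall>a b. p t a b \<ge> 0) \<and>
     (\<forall>t\<ge>0. \<forall>a. (p t a has_sum 1) UNIV) \<and>
     (\<forall>a b. p 0 a b = (if a = b then 1 else 0)) \<and>
     (\<forall>s\<ge>0. \<forall>t\<ge>0. \<forall>a b. ((\<lambda>c. p s a c * p t c b) has_sum p (s + t) a b) UNIV)"

definition has_rates :: "(real \<Rightarrow> 's \<Rightarrow> 's \<Rightarrow> real) \<Rightarrow> ('s \<Rightarrow> 's \<Rightarrow> real) \<Rightarrow> bool" where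
  "has_rates p Q \<longleftrightarrow>
     (\<forall>a b. ((\<lambda>t. p t a b) has_real_derivative Q a b) (at 0 within {0..}))"

text \<open>Non-explosive time-homogeneous continuous-time Markov chain with transition rates \<open>Q\<close>: the
  rates are the derivative at \<open>0\<close> of the transition probabilities. Regularity of the sample paths
  is not required, as it has no bearing on finite-dimensional distributions.\<close>

definition ct_markov_chain ::
    "'a measure \<Rightarrow> ('s \<Rightarrow> 's \<Rightarrow> real) \<Rightarrow> (real \<Rightarrow> 'a \<Rightarrow> 's) \<Rightarrow> bool" where
  "ct_markov_chain M Q Z \<longleftrightarrow>
     prob_space M \<and>
     (\<forall>t\<ge>0. Z t \<in> measurable M (count_space UNIV)) \<and>
     (\<exists>p. transition_function p \<and> has_rates p Q \<and>
        (\<forall>m s x. 0 \<le> s 0 \<and> (\<forall>i\<le>m. s i < s (Suc i)) \<and>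
             measure M {\<omega> \<in> space M. \<forall>i\<le>m. Z (s i) \<omega> = x i} > 0 \<longrightarrow>
           cond_prob M (\<lambda>\<omega>. Z (s (Suc m)) \<omega> = x (Suc m)) (\<lambda>\<omega>. \<forall>i\<le>m. Z (s i) \<omega> = x i)
             = p (s (Suc m) - s m) (x m) (x (Suc m))))"

text \<open>Used for even \<open>n\<close> and \<open>t \<ge> 0\<close> only, so that \<open>div\<close> and \<open>nat\<close> are exact.\<close>

definition Y_proc :: "nat \<Rightarrow> nat \<Rightarrow> (nat \<Rightarrow> 'a \<Rightarrow> nat) \<Rightarrow> real \<Rightarrow> 'a \<Rightarrow> int" where
  "Y_proc q n X t \<omega> =
     int (X (2 * nat \<lfloor>real q ^ (n div 2) * (real q - 1) * t\<rfloor>) \<omega>) - int (n div 2)"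

definition tv_dist :: "'b measure \<Rightarrow> 'b measure \<Rightarrow> real" where
  "tv_dist \<mu> \<nu> = (SUP A\<in>sets \<mu>. \<bar>measure \<mu> A - measure \<nu> A\<bar>)"

text \<open>The joint law of \<open>(V t\<^sub>1, \<dots>, V t\<^sub>k)\<close>; the vectors form a countable set, which
  carries the discrete sigma-algebra.\<close>

definition joint_law :: "'a measure \<Rightarrow> (real \<Rightarrow> 'a \<Rightarrow> int) \<Rightarrow> real list \<Rightarrow> int list measure" where
  "joint_law M V ts = distr M (count_space UNIV) (\<lambda>\<omega>. map (\<lambda>t. V t \<omega>) ts)"

end

theory Submission
  imports Defs
begin

text \<open>
  Write \<open>n = 2 * l\<close>, let \<open>N = q ^ l * (q - 1)\<close> and centre the state as \<open>d = l + a\<close>. One step of the chain is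
  the rank of a uniform \<open>(n - d) \<times> n\<close> matrix over the field with \<open>q\<close> elements. Such a matrix nearly always has full rank,
  which sends \<open>a\<close> to \<open>- a\<close>; the rank drops by one, sending \<open>a\<close> to \<open>- a - 1\<close>, with probability about
  \<open>q powi (- a) / N\<close>. Two steps therefore lead from \<open>a\<close> back to \<open>a\<close>, except that a drop in the first
  step gives \<open>a + 1\<close> (probability about \<open>q powi (- a) / N\<close>) and a drop in the second gives \<open>a - 1\<close>
  (probability about \<open>q powi a / N\<close>). These are the rates of \<open>Z\<close>, in the time unit \<open>1 / N\<close>.

  To pass to the limit it suffices to bound probabilities from below: the limiting law has total mass
  one, so if the limit inferior of each point mass is at least the limiting point mass, no
  mass is left over and the convergence is in total variation (\<open>tv_dist_tendsto_zero\<close>). For lower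
  bounds the two-step kernel may be restricted to a finite window \<open>W = {- R..R}\<close>, where its convergence to the
  rates is uniform. The price is the probability that \<open>Z\<close> leaves the window before time \<open>s\<close>. As the
  generator of \<open>Z\<close> increases the function \<open>\<lambda>a. \<bar>a\<bar>\<close> at rate at most 2, this probability is at most
  \<open>(\<bar>a\<bar> + 2 * s) / (R + 1)\<close>, which is small for large \<open>R\<close>.

  The comparison is an induction on the number of steps
  (\<open>transition_function_le_restricted_iterate\<close>): it sets the restricted iterates directly against the
  transition function of \<open>Z\<close> along a time grid, through the semigroup property, total mass
  one and the derivatives at time 0. The Markov properties of both processes then extend the bound from one time to
  a finite sequence of times (\<open>path_probability_lower_limit\<close>).
\<close>

section \<open>Transition probabilities and q-Pochhammer products\<close>

lemma one_minus_sum_le_prod: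
  fixes x :: "'i \<Rightarrow> real"
  assumes "finite I" "\<And>i. i \<in> I \<Longrightarrow> 0 \<le> x i" "\<And>i. i \<in> I \<Longrightarrow> x i \<le> 1"
  shows "1 - (\<Sum>i\<in>I. x i) \<le> (\<Prod>i\<in>I. 1 - x i)"
  using assms
proof (induction I)
  case (insert j I)
  have "(\<Prod>i\<in>I. 1 - x i) \<le> 1"
    by (rule prod_le_1) (use insert in auto)
  then have "x j * (\<Prod>i\<in>I. 1 - x i) \<le> x j"
    using insert.prems(1)[of j] by (simp add: mult_left_le)
  with insert show ?case by (simp add: algebra_simps)
qed simp

lemma q_poch_Suc: "q_poch a q (Suc r) = q_poch a q r * (1 - a * q ^ r)"
  by (simp add: q_poch_def)

lemma q_poch_Suc_shift: "q_poch a q (Suc r) = (1 - a) * q_poch (a * q) q r"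
  unfolding q_poch_def by (subst prod.lessThan_Suc_shift) (simp add: mult.assoc)

text \<open>The product is \<open>\<Prod>i<r. 1 - q ^ i / q ^ n\<close>; the subtracted terms form a geometric series.\<close>

lemma q_poch_lower_bound:
  fixes q :: real
  assumes q: "q > 1" and "r \<le> n"
  shows "1 - q ^ r / (q ^ n * (q - 1)) \<le> q_poch (q powi (- int n)) q r"
proof -
  have e: "q powi (- int n) * q ^ i = q ^ i / q ^ n" for i
    by (simp add: power_int_minus divide_simps)
  have le: "q ^ i / q ^ n \<le> 1" if "i < r" for i
    using that assms by (simp add: power_increasing)
  have "1 - (\<Sum>i<r. q ^ i / q ^ n) \<le> (\<Prod>i<r. 1 - q ^ i / q ^ n)"
    by (rule one_minus_sum_le_prod) (use le q in auto)
  moreover have "(\<Sum>i<r. q ^ i / q ^ n) = ((q ^ r - 1) / (q - 1)) / q ^ n"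
    using q by (simp add: geometric_sum flip: sum_divide_distrib)
  moreover have "((q ^ r - 1) / (q - 1)) / q ^ n \<le> q ^ r / (q ^ n * (q - 1))"
    using q by (simp add: divide_simps)
  ultimately show ?thesis
    by (simp add: q_poch_def e)
qed

lemma q_poch_pos:
  fixes q :: real
  assumes q: "q > 1" and "r \<le> n"
  shows "q_poch (q powi (- int n)) q r > 0"
  unfolding q_poch_def
proof (rule prod_pos)
  fix i assume "i \<in> {..<r}"
  then have "q ^ i < q ^ n" using assms by (intro power_strict_increasing) auto
  moreover have "q powi (- int n) * q ^ i = q ^ i / q ^ n"
    by (simp add: power_int_minus divide_simps)
  ultimately show "0 < 1 - q powi (- int n) * q ^ i" using q by simp
qed

lemma P_mat_nonneg:
  assumes "q \<ge> 2"
  shows "P_mat q n d r \<ge> 0"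
proof (cases "d + r \<le> n")
  case True
  have e: "- (int n - int d) = - int (n - d)" using True by simp
  have "q_poch (real q powi (- int k)) (real q) r > 0" if "r \<le> k" for k
    using assms that by (intro q_poch_pos) auto
  from this[of n] this[of "n - d"] this[of r]
  have "q_poch (real q powi (- int n)) (real q) r > 0"
    "q_poch (real q powi (- int (n - d))) (real q) r > 0"
    "q_poch (real q powi (- int r)) (real q) r > 0"
    using True by auto
  then show ?thesis using True
    unfolding P_mat_def e by simp
qed (simp add: P_mat_def)

text \<open>Two of the three products cancel. What remains is, for a prime power \<open>q\<close>, the probability that a uniform
  \<open>(n - d) \<times> n\<close> matrix has full rank.\<close>

lemma P_mat_reflect:
  assumes "q \<ge> 2" "d \<le> n"
  shows "P_mat q n d (n - d) \<ge> 1 - 1 / (real q ^ d * (real q - 1))"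
proof -
  have q: "real q > 1" using assms by simp
  have e: "- (int n - int d) = - int (n - d)" using assms by simp
  have e': "int n - int d - int (n - d) = 0" using assms by simp
  have "P_mat q n d (n - d) = q_poch (real q powi (- int n)) (real q) (n - d)"
    using q_poch_pos[OF q, of "n - d" "n - d"] assms
    unfolding P_mat_def e e' by simp
  also have "\<dots> \<ge> 1 - real q ^ (n - d) / (real q ^ n * (real q - 1))"
    by (rule q_poch_lower_bound) (use q in auto)
  also have "real q ^ (n - d) / (real q ^ n * (real q - 1)) = 1 / (real q ^ d * (real q - 1))"
    using q assms by (simp add: power_diff)
  finally show ?thesis .
qed

text \<open>The case of rank one less than full. The quotient of the two products that
  cancelled for full rank now differs by one factor at each end, and its limit \<open>1 / (1 - 1 / q)\<close> for large \<open>n - d\<close> is what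
  turns \<open>q ^ (d + 1)\<close> into \<open>q ^ d * (q - 1)\<close>.\<close>

lemma P_mat_reflect_pred:
  assumes "q \<ge> 2" "d < n"
  defines "h \<equiv> 1 / (real q ^ d * (real q - 1))"
  shows "P_mat q n d (n - d - 1) \<ge> h * (1 - 1 / real q ^ (n - d)) * (1 - h)"
proof -
  have q: "real q > 1" using assms by simp
  define r where "r = n - d - 1"
  have n: "n = d + Suc r" using assms by (simp add: r_def)
  define A B where "A = q_poch (real q powi (- int (Suc r))) (real q) r"
    and "B = q_poch (real q powi (- int r)) (real q) r"
  define C where "C = q_poch (real q powi (- int n)) (real q) r"
  have B: "B > 0" unfolding B_def by (rule q_poch_pos) (use q in auto)
  have pw: "real q powi (- int k) = 1 / real q ^ k" for k
    by (simp add: power_int_minus divide_simps)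
  have sh: "real q powi (- int (Suc r)) * real q = real q powi (- int r)"
    using q unfolding pw by simp
  have l: "real q powi (- int (Suc r)) * real q ^ r = 1 / real q"
    using q unfolding pw by simp
  have "A * (1 - 1 / real q) = (1 - 1 / real q ^ Suc r) * B"
    using q_poch_Suc[of "real q powi (- int (Suc r))" "real q" r]
      q_poch_Suc_shift[of "real q powi (- int (Suc r))" "real q" r]
    unfolding A_def B_def sh l unfolding pw by simp
  then have AB: "A / B = (1 - 1 / real q ^ Suc r) / (1 - 1 / real q)"
    using B q by (simp add: frac_eq_eq)
  have "C \<ge> 1 - real q ^ r / (real q ^ n * (real q - 1))"
    unfolding C_def by (rule q_poch_lower_bound) (use q n in auto)
  moreover have "real q ^ r / (real q ^ n * (real q - 1)) \<le> h"
  proof -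
    have "real q ^ r / (real q ^ n * (real q - 1)) = 1 / (real q ^ Suc d * (real q - 1))"
      using q unfolding n by (simp add: power_add)
    also have "\<dots> \<le> h"
      unfolding h_def using q
      by (intro divide_left_mono mult_right_mono power_increasing) auto
    finally show ?thesis .
  qed
  ultimately have C: "C \<ge> 1 - h" by simp
  have e: "- (int n - int d) = - int (Suc r)"
    "- ((int n - int d - int r) * (int n - int r)) = - int (Suc d)"
    by (auto simp: n algebra_simps)
  have "P_mat q n d r = real q powi (- int (Suc d)) * (A * C) / B"
    unfolding P_mat_def e A_def B_def C_def using n by simp
  also have "\<dots> = real q powi (- int (Suc d)) * (A / B) * C" by simp
  also have "real q powi (- int (Suc d)) * (A / B) = h * (1 - 1 / real q ^ Suc r)"
    using q unfolding AB h_def pw by (simp add: field_simps)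
  finally have "P_mat q n d r = h * (1 - 1 / real q ^ Suc r) * C" .
  moreover have "h * (1 - 1 / real q ^ Suc r) \<ge> 0"
    using q one_le_power[of "real q" "Suc r"] unfolding h_def by (intro mult_nonneg_nonneg) auto
  ultimately have "P_mat q n d r \<ge> h * (1 - 1 / real q ^ Suc r) * (1 - h)"
    using C by (simp add: mult_left_mono)
  then show ?thesis unfolding r_def using assms by (simp add: Suc_diff_Suc flip: r_def)
qed

section \<open>Rates of the chain observed at even times\<close>

text \<open>Number of double steps of the chain per unit of time, for \<open>n = 2 * l\<close>.\<close>

definition time_scale :: "nat \<Rightarrow> nat \<Rightarrow> real" where
  "time_scale q l = real q ^ l * (real q - 1)"

text \<open>The kernel of the chain observed at even times, in the centred coordinate.\<close>

definition two_step :: "nat \<Rightarrow> nat \<Rightarrow> int \<Rightarrow> int \<Rightarrow> real" where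
  "two_step q l a b =
     (\<Sum>r\<le>2 * l. P_mat q (2 * l) (nat (int l + a)) r * P_mat q (2 * l) r (nat (int l + b)))"

lemma two_step_nonneg: "2 \<le> q \<Longrightarrow> 0 \<le> two_step q l a b"
  unfolding two_step_def by (intro sum_nonneg mult_nonneg_nonneg P_mat_nonneg)

lemma two_step_ge:
  assumes "2 \<le> q" "r \<le> 2 * l"
  shows "P_mat q (2 * l) (nat (int l + a)) r * P_mat q (2 * l) r (nat (int l + b)) \<le> two_step q l a b"
  unfolding two_step_def
  by (rule member_le_sum[of r "{..2 * l}"
        "\<lambda>r. P_mat q (2 * l) (nat (int l + a)) r * P_mat q (2 * l) r (nat (int l + b))"])
    (use assms in \<open>auto intro!: mult_nonneg_nonneg P_mat_nonneg\<close>)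

lemma time_scale_at_top:
  assumes "2 \<le> q"
  shows "filterlim (time_scale q) at_top sequentially"
  unfolding time_scale_def
  by (rule filterlim_at_top_mult_tendsto_pos[OF tendsto_const])
    (use assms in \<open>auto intro!: filterlim_at_infinity_imp_filterlim_at_top filterlim_realpow_sequentially_gt1\<close>)

lemma inverse_power_time_scale:
  assumes "2 \<le> q" "- int l \<le> a"
  shows "1 / (real q ^ nat (int l + a) * (real q - 1)) = real q powi (- a) / time_scale q l"
proof -
  have "real q ^ nat (int l + a) = real q powi (int l + a)"
    using assms by (simp add: power_int_def)
  also have "\<dots> = real q ^ l * real q powi a"
    using assms by (simp add: power_int_add)
  finally show ?thesis
    using assms by (simp add: time_scale_def power_int_minus field_simps)
qed

lemma P_mat_centred_reflect:
  assumes q: "2 \<le> q" and a: "- int l \<le> a" "a \<le> int l"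
  shows "1 - real q powi (- a) / time_scale q l
    \<le> P_mat q (2 * l) (nat (int l + a)) (nat (int l - a))"
proof -
  have d: "nat (int l + a) \<le> 2 * l" and r: "2 * l - nat (int l + a) = nat (int l - a)"
    using a by auto
  show ?thesis
    using P_mat_reflect[OF q d] unfolding r inverse_power_time_scale[OF q a(1)] .
qed

lemma P_mat_centred_reflect_pred:
  assumes q: "2 \<le> q" and a: "- int l \<le> a" "a < int l"
  shows "real q powi (- a) / time_scale q l * (1 - real q powi a * (1 / real q) ^ l)
      * (1 - real q powi (- a) / time_scale q l)
    \<le> P_mat q (2 * l) (nat (int l + a)) (nat (int l - a - 1))"
proof -
  have d: "nat (int l + a) < 2 * l" and r: "2 * l - nat (int l + a) = nat (int l - a)"
    and r': "nat (int l - a) - 1 = nat (int l - a - 1)"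
    using a by auto
  have "1 / real q ^ nat (int l - a) = real q powi (a - int l)"
    using a power_int_minus[of "real q" "int l - a"] by (simp add: power_int_def divide_inverse)
  also have "\<dots> = real q powi a * (1 / real q) ^ l"
    using q by (simp add: power_int_diff power_one_over)
  finally have e: "1 / real q ^ nat (int l - a) = real q powi a * (1 / real q) ^ l" .
  show ?thesis
    using P_mat_reflect_pred[OF q d] unfolding r r' e inverse_power_time_scale[OF q a(1)] .
qed

text \<open>A single intermediate state accounts for each transition to leading order: \<open>l - a - 1\<close>
  for \<open>a + 1\<close>, and \<open>l - a\<close> for \<open>a\<close> and \<open>a - 1\<close>. All other routes are discarded.\<close>

lemma two_step_rates:
  assumes q: "2 \<le> q" and \<epsilon>: "0 < \<epsilon>"
  shows "\<forall>\<^sub>F l in sequentially. of_bool (a = b) + (Q_Z q a b - \<epsilon>) / time_scale q l \<le> two_step q l a b"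
proof -
  define N where "N = time_scale q"
  define x where "x c l = real q powi c / N l" for c l
  define y where "y c l = real q powi c * (1 / real q) ^ l" for c l
  have Npos: "\<forall>\<^sub>F l in sequentially. 0 < N l"
    using time_scale_at_top[OF q] by (simp add: filterlim_at_top_dense N_def)
  have x: "x c \<longlonglongrightarrow> 0" for c
    unfolding x_def N_def
    by (rule tendsto_divide_0[OF tendsto_const filterlim_at_top_imp_at_infinity[OF time_scale_at_top[OF q]]])
  have y: "y c \<longlonglongrightarrow> 0" for c
    unfolding y_def
    by (rule tendsto_mult_right_zero, rule LIMSEQ_realpow_zero) (use q in auto)
  have x1: "\<forall>\<^sub>F l in sequentially. x c l < 1" and y1: "\<forall>\<^sub>F l in sequentially. y c l < 1" for c
    using order_tendstoD(2)[OF x] order_tendstoD(2)[OF y] by simp_all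
  have large: "\<forall>\<^sub>F l in sequentially. \<bar>a\<bar> + 1 < int l"
    using eventually_gt_at_top[of "nat (\<bar>a\<bar> + 1)"] by eventually_elim linarith
  consider "b = a + 1" | "b = a - 1" | "b = a" | "b \<noteq> a + 1" "b \<noteq> a - 1" "b \<noteq> a"
    by blast
  then have "\<forall>\<^sub>F l in sequentially. of_bool (a = b) + (Q_Z q a b - \<epsilon>) / N l \<le> two_step q l a b"
  proof cases
    case 1
    define g where "g l = real q powi (- a) * (1 - y a l) * (1 - x (- a) l) * (1 - x (a + 1) l)" for l
    have "g \<longlonglongrightarrow> real q powi (- a) * (1 - 0) * (1 - 0) * (1 - 0)"
      unfolding g_def by (intro tendsto_intros x y)
    then have "\<forall>\<^sub>F l in sequentially. real q powi (- a) - \<epsilon> < g l"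
      by (rule order_tendstoD) (use \<epsilon> in simp)
    with Npos large x1[of "- a"] x1[of "a + 1"] y1[of a] show ?thesis
    proof eventually_elim
      case (elim l)
      have "(real q powi (- a) - \<epsilon>) / N l \<le> g l / N l"
        using elim by (intro divide_right_mono) auto
      also have "\<dots> = (x (- a) l * (1 - y a l) * (1 - x (- a) l)) * (1 - x (a + 1) l)"
        by (simp add: g_def x_def)
      also have "\<dots> \<le> P_mat q (2 * l) (nat (int l + a)) (nat (int l - a - 1))
          * P_mat q (2 * l) (nat (int l - a - 1)) (nat (int l + b))"
        using P_mat_centred_reflect_pred[OF q, of l a] P_mat_centred_reflect[OF q, of l "- a - 1"] elim q
        by (intro mult_mono P_mat_nonneg) (auto simp: x_def y_def N_def 1 algebra_simps)
      also have "\<dots> \<le> two_step q l a b"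
        using elim by (intro two_step_ge[OF q]) auto
      finally show ?case by (simp add: Q_Z_def 1)
    qed
  next
    case 2
    define g where "g l = (1 - x (- a) l) * (real q powi a * (1 - y (- a) l) * (1 - x a l))" for l
    have "g \<longlonglongrightarrow> (1 - 0) * (real q powi a * (1 - 0) * (1 - 0))"
      unfolding g_def by (intro tendsto_intros x y)
    then have "\<forall>\<^sub>F l in sequentially. real q powi a - \<epsilon> < g l"
      by (rule order_tendstoD) (use \<epsilon> in simp)
    with Npos large x1[of "- a"] x1[of a] y1[of "- a"] show ?thesis
    proof eventually_elim
      case (elim l)
      have "(real q powi a - \<epsilon>) / N l \<le> g l / N l"
        using elim by (intro divide_right_mono) auto
      also have "\<dots> = (1 - x (- a) l) * (x a l * (1 - y (- a) l) * (1 - x a l))"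
        by (simp add: g_def x_def)
      also have "\<dots> \<le> P_mat q (2 * l) (nat (int l + a)) (nat (int l - a))
          * P_mat q (2 * l) (nat (int l - a)) (nat (int l + b))"
      proof (rule mult_mono)
        show "1 - x (- a) l \<le> P_mat q (2 * l) (nat (int l + a)) (nat (int l - a))"
          using P_mat_centred_reflect[OF q, of l a] elim by (simp add: x_def N_def)
        have e: "int l + b = int l - - a - 1" "int l - a = int l + - a" by (simp_all add: 2)
        show "x a l * (1 - y (- a) l) * (1 - x a l)
            \<le> P_mat q (2 * l) (nat (int l - a)) (nat (int l + b))"
          using P_mat_centred_reflect_pred[OF q, of l "- a"] elim
          unfolding e by (simp add: x_def y_def N_def)
        show "0 \<le> x a l * (1 - y (- a) l) * (1 - x a l)"
          using elim by (intro mult_nonneg_nonneg) (auto simp: x_def)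
      qed (rule P_mat_nonneg[OF q])
      also have "\<dots> \<le> two_step q l a b"
        using elim by (intro two_step_ge[OF q]) auto
      finally show ?case by (simp add: Q_Z_def 2)
    qed
  next
    case 3
    from Npos large x1[of "- a"] x1[of a] show ?thesis
    proof eventually_elim
      case (elim l)
      have "0 \<le> x (- a) l * x a l" using elim by (simp add: x_def)
      moreover have "\<epsilon> / N l > 0" using elim \<epsilon> by simp
      moreover have "(Q_Z q a a - \<epsilon>) / N l = - x a l - x (- a) l - \<epsilon> / N l"
        by (simp add: Q_Z_def x_def diff_divide_distrib)
      ultimately have "1 + (Q_Z q a a - \<epsilon>) / N l \<le> (1 - x (- a) l) * (1 - x a l)"
        by (simp add: algebra_simps)
      also have "\<dots> \<le> P_mat q (2 * l) (nat (int l + a)) (nat (int l - a))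
          * P_mat q (2 * l) (nat (int l - a)) (nat (int l + b))"
        using P_mat_centred_reflect[OF q, of l a] P_mat_centred_reflect[OF q, of l "- a"] elim q
        by (intro mult_mono P_mat_nonneg) (auto simp: x_def N_def 3)
      also have "\<dots> \<le> two_step q l a b"
        using elim by (intro two_step_ge[OF q]) auto
      finally show ?case by (simp add: 3)
    qed
  next
    case 4
    then have Q0: "Q_Z q a b = 0" by (simp add: Q_Z_def)
    from Npos show ?thesis
    proof eventually_elim
      case (elim l)
      have "(Q_Z q a b - \<epsilon>) / N l \<le> 0" using elim Q0 \<epsilon> by simp
      also have "\<dots> \<le> two_step q l a b" by (rule two_step_nonneg[OF q])
      finally show ?case using 4 by simp
    qed
  qed
  then show ?thesis by (simp add: N_def)
qed

section \<open>Restricted iterates and transition functions\<close>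

text \<open>Backward operator of the kernel killed outside \<open>W\<close>: iterated on \<open>indicator {b}\<close>, it gives the
  mass of the paths to \<open>b\<close> all of whose steps end in \<open>W\<close>.\<close>

definition restricted_step :: "'s set \<Rightarrow> ('s \<Rightarrow> 's \<Rightarrow> real) \<Rightarrow> ('s \<Rightarrow> real) \<Rightarrow> 's \<Rightarrow> real" where
  "restricted_step W K f a = (\<Sum>c\<in>W. K a c * f c)"

lemma restricted_step_funpow_nonneg:
  assumes "\<And>a c. a \<in> W \<Longrightarrow> c \<in> W \<Longrightarrow> 0 \<le> K a c" "\<And>c. 0 \<le> f c" "a \<in> W"
  shows "0 \<le> (restricted_step W K ^^ k) f a"
  using assms(3)
  by (induction k arbitrary: a) (auto simp: restricted_step_def assms intro!: sum_nonneg)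

lemma transition_functionD:
  assumes "transition_function p" "0 \<le> t"
  shows "0 \<le> p t a b" "(p t a has_sum 1) UNIV" "p t a b \<le> 1"
    "p 0 a b = (if a = b then 1 else 0)"
    "0 \<le> s \<Longrightarrow> ((\<lambda>c. p s a c * p t c b) has_sum p (s + t) a b) UNIV"
proof -
  show 1: "0 \<le> p t a b" for a b using assms by (auto simp: transition_function_def)
  show 2: "(p t a has_sum 1) UNIV" using assms by (auto simp: transition_function_def)
  show "p t a b \<le> 1"
    using finite_sum_le_has_sum[OF 2, of "{b}"] 1 by simp
  show "p 0 a b = (if a = b then 1 else 0)"
    "0 \<le> s \<Longrightarrow> ((\<lambda>c. p s a c * p t c b) has_sum p (s + t) a b) UNIV"
    using assms by (auto simp: transition_function_def)
qed

text \<open>In one step of length \<open>h\<close> the continuous chain either lands in \<open>W\<close>, where \<open>p h\<close> is at most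
  \<open>K + \<delta>\<close>, or outside. The function \<open>f\<close>, extended by 0 outside \<open>W\<close>, is nearly
  subharmonic, so that \<open>1 - f a\<close> plus the accumulated drift error bounds the probability of
  landing outside within \<open>k\<close> steps from \<open>a\<close>. Both errors are carried through one induction.\<close>

lemma transition_function_le_restricted_iterate:
  fixes p :: "real \<Rightarrow> 's \<Rightarrow> 's \<Rightarrow> real"
  assumes p: "transition_function p" and h: "0 \<le> h" and W: "finite W"
    and K0: "\<And>a c. a \<in> W \<Longrightarrow> c \<in> W \<Longrightarrow> 0 \<le> K a c"
    and K: "\<And>a c. a \<in> W \<Longrightarrow> c \<in> W \<Longrightarrow> p h a c \<le> K a c + \<delta>"
    and f: "\<And>c. c \<in> W \<Longrightarrow> 0 \<le> f c" "\<And>c. c \<in> W \<Longrightarrow> f c \<le> 1"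
    and drift: "\<And>a. a \<in> W \<Longrightarrow> f a - \<eta> \<le> restricted_step W (p h) f a"
    and nn: "0 \<le> \<delta>" "0 \<le> \<eta>" and a: "a \<in> W"
  shows "p (real k * h) a b
    \<le> (restricted_step W K ^^ k) (indicator {b}) a + (1 - f a) + real k * (\<eta> + real (card W) * \<delta>)"
  using a
proof (induction k arbitrary: a)
  case 0
  then show ?case
    using transition_functionD(4)[OF p order_refl, of a b] f(2)[of a] by (auto simp: indicator_def)
next
  case (Suc k)
  define e where "e = \<eta> + real (card W) * \<delta>"
  define v where "v = (restricted_step W K ^^ k) (indicator {b})"
  \<comment> \<open>Truncation at 1 makes the error \<open>\<delta>\<close> in the kernel count at most once for each state of \<open>W\<close>.\<close>
  define v' where "v' c = min (v c) 1" for c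
  have e: "0 \<le> e" using nn by (simp add: e_def)
  have v0: "0 \<le> v c" if "c \<in> W" for c
    unfolding v_def by (rule restricted_step_funpow_nonneg) (use K0 that in auto)
  have kh: "0 \<le> real k * h" using h by simp
  note ph = transition_functionD[OF p h]
  have IH: "p (real k * h) c b \<le> v' c + (1 - f c) + real k * e" if "c \<in> W" for c
    using Suc.IH[OF that] transition_functionD(3)[OF p kh, of c b] f(2)[OF that] e
    unfolding v'_def v_def e_def by (smt (verit) mult_nonneg_nonneg of_nat_0_le_iff)
  define g where "g c = (if c \<in> W then p h a c * (v' c - f c + real k * e) else 0) + p h a c" for c
  have "((\<lambda>c. if c \<in> W then p h a c * (v' c - f c + real k * e) else 0)
      has_sum (\<Sum>c\<in>W. p h a c * (v' c - f c + real k * e))) UNIV"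
    by (rule has_sum_finite_neutralI[OF W]) auto
  then have g: "(g has_sum (\<Sum>c\<in>W. p h a c * (v' c - f c + real k * e)) + 1) UNIV"
    unfolding g_def by (intro has_sum_add ph(2))
  have "p (h + real k * h) a b \<le> (\<Sum>c\<in>W. p h a c * (v' c - f c + real k * e)) + 1"
  proof (rule has_sum_mono[OF transition_functionD(5)[OF p kh h] g])
    fix c
    show "p h a c * p (real k * h) c b \<le> g c"
    proof (cases "c \<in> W")
      case True
      have "p h a c * p (real k * h) c b \<le> p h a c * (v' c + (1 - f c) + real k * e)"
        by (intro mult_left_mono IH True ph(1))
      then show ?thesis using True by (simp add: g_def algebra_simps)
    next
      case False
      then show ?thesis
        using transition_functionD(3)[OF p kh, of c b] ph(1) by (simp add: g_def mult_left_le)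
    qed
  qed
  also have "(\<Sum>c\<in>W. p h a c * (v' c - f c + real k * e))
      = (\<Sum>c\<in>W. p h a c * v' c) - restricted_step W (p h) f a + real k * e * (\<Sum>c\<in>W. p h a c)"
    unfolding restricted_step_def sum_distrib_left sum_subtractf[symmetric] sum.distrib[symmetric]
    by (intro sum.cong) (auto simp: algebra_simps)
  also have "real k * e * (\<Sum>c\<in>W. p h a c) \<le> real k * e"
    using finite_sum_le_has_sum[OF ph(2) W, of a] ph(1) e by (intro mult_left_le) auto
  also have "(\<Sum>c\<in>W. p h a c * v' c) \<le> (\<Sum>c\<in>W. K a c * v c + \<delta>)"
  proof (rule sum_mono)
    fix c assume c: "c \<in> W"
    have v': "0 \<le> v' c" "v' c \<le> 1" "v' c \<le> v c" using v0[OF c] by (auto simp: v'_def)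
    have "p h a c * v' c \<le> (K a c + \<delta>) * v' c"
      using K[OF Suc.prems c] v' by (intro mult_right_mono)
    also have "\<dots> \<le> K a c * v c + \<delta>"
      using v' nn K0[OF Suc.prems c] by (simp add: distrib_right add_mono mult_left_mono mult_left_le)
    finally show "p h a c * v' c \<le> K a c * v c + \<delta>" .
  qed
  also have "\<dots> = restricted_step W K v a + real (card W) * \<delta>"
    by (simp add: restricted_step_def sum.distrib)
  finally have "p (h + real k * h) a b \<le> restricted_step W K v a + real (card W) * \<delta>
      - restricted_step W (p h) f a + real k * e + 1" by simp
  with drift[OF Suc.prems] show ?case
    by (simp add: algebra_simps e_def v_def)
qed

text \<open>Applied with the grid of mesh \<open>h = s / m\<close>, which hits the time \<open>s\<close> exactly and
  satisfies \<open>h * N \<longlonglongrightarrow> 1\<close>. Per step the error of the comparison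
  is \<open>o(h)\<close> apart from the drift; what survives after \<open>m\<close> steps is
  the loss \<open>1 - f a\<close> at the start and the total drift \<open>s * \<kappa>\<close>.\<close>

proposition restricted_iterate_lower_limit:
  fixes p :: "real \<Rightarrow> 's \<Rightarrow> 's \<Rightarrow> real" and K :: "nat \<Rightarrow> 's \<Rightarrow> 's \<Rightarrow> real"
    and N :: "nat \<Rightarrow> real" and m :: "nat \<Rightarrow> nat"
  assumes p: "transition_function p" "has_rates p Q" and W: "finite W" and s: "0 < s"
    and N: "filterlim N at_top sequentially" and m: "(\<lambda>l. real (m l) / N l) \<longlonglongrightarrow> s"
    and K0: "\<And>a c. a \<in> W \<Longrightarrow> c \<in> W \<Longrightarrow> \<forall>\<^sub>F l in sequentially. 0 \<le> K l a c"
    and K: "\<And>a c \<epsilon>. a \<in> W \<Longrightarrow> c \<in> W \<Longrightarrow> 0 < \<epsilon> \<Longrightarrow>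
      \<forall>\<^sub>F l in sequentially. of_bool (a = c) + (Q a c - \<epsilon>) / N l \<le> K l a c"
    and f: "\<And>c. c \<in> W \<Longrightarrow> 0 \<le> f c" "\<And>c. c \<in> W \<Longrightarrow> f c \<le> 1"
    and drift: "\<And>a. a \<in> W \<Longrightarrow> - \<kappa> \<le> (\<Sum>c\<in>W. Q a c * f c)" and \<kappa>: "0 \<le> \<kappa>"
    and a: "a \<in> W" and \<epsilon>: "0 < \<epsilon>"
  shows "\<forall>\<^sub>F l in sequentially. p s a b
    \<le> (restricted_step W (K l) ^^ m l) (indicator {b}) a + (1 - f a) + s * \<kappa> + \<epsilon>"
proof -
  define w where "w = real (card W)"
  \<comment> \<open>The error \<open>h * \<delta>\<close> per entry enters twice for each state of \<open>W\<close>, in the drift and in the kernel.\<close>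
  define \<delta> where "\<delta> = \<epsilon> / (s * (2 * w + 1))"
  have w: "0 \<le> w" by (simp add: w_def)
  have \<delta>: "0 < \<delta>" using \<epsilon> s w by (simp add: \<delta>_def add_nonneg_pos)
  have s\<delta>: "s * (2 * w * \<delta>) \<le> \<epsilon>"
  proof -
    have "s * (2 * w * \<delta>) = \<epsilon> * (2 * w / (2 * w + 1))"
      using s w by (simp add: \<delta>_def)
    also have "\<dots> \<le> \<epsilon>"
      using w \<epsilon> by (intro mult_left_le) auto
    finally show ?thesis .
  qed
  define h where "h l = s / real (m l)" for l
  have Npos: "\<forall>\<^sub>F l in sequentially. 0 < N l"
    using N by (simp add: filterlim_at_top_dense)
  have "filterlim (\<lambda>l. real (m l) / N l * N l) at_top sequentially"
    by (rule filterlim_tendsto_pos_mult_at_top[OF m s N])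
  then have m_top: "filterlim (\<lambda>l. real (m l)) at_top sequentially"
    by (rule filterlim_mono_eventually) (use Npos in \<open>auto elim: eventually_mono\<close>)
  then have mpos: "\<forall>\<^sub>F l in sequentially. 0 < real (m l)"
    unfolding filterlim_at_top_dense by blast
  have h0: "h \<longlonglongrightarrow> 0"
    unfolding h_def by (rule tendsto_divide_0[OF tendsto_const filterlim_at_top_imp_at_infinity[OF m_top]])
  have hpos: "\<forall>\<^sub>F l in sequentially. 0 < h l"
    using mpos by eventually_elim (simp add: h_def s)
  have h_within: "filterlim h (at 0 within {0..}) sequentially"
    unfolding filterlim_at using h0 hpos by (auto elim: eventually_mono)
  have "(\<lambda>l. s / (real (m l) / N l)) \<longlonglongrightarrow> s / s"
    by (intro tendsto_intros m) (use s in auto)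
  then have hN: "(\<lambda>l. h l * N l) \<longlonglongrightarrow> 1"
    using s by (simp add: h_def)
  have p0: "p 0 a c = of_bool (a = c)" for a c
    using transition_functionD(4)[OF p(1) order_refl, of a c] by simp
  have p_rate: "\<forall>\<^sub>F l in sequentially. \<bar>p (h l) a c - of_bool (a = c) - h l * Q a c\<bar> \<le> h l * (\<delta> / 2)"
    for a c
  proof -
    have "((\<lambda>t. p t a c) has_real_derivative Q a c) (at 0 within {0..})"
      using p(2) by (simp add: has_rates_def)
    then have "((\<lambda>t. (p t a c - p 0 a c) / (t - 0)) \<longlongrightarrow> Q a c) (at 0 within {0..})"
      unfolding has_field_derivative_iff .
    from filterlim_compose[OF this h_within]
    have "(\<lambda>l. (p (h l) a c - of_bool (a = c)) / h l) \<longlonglongrightarrow> Q a c"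
      by (simp add: p0)
    then have "\<forall>\<^sub>F l in sequentially. dist ((p (h l) a c - of_bool (a = c)) / h l) (Q a c) < \<delta> / 2"
      by (rule tendstoD) (use \<delta> in simp)
    with hpos show ?thesis
    proof eventually_elim
      case (elim l)
      then have "\<bar>(p (h l) a c - of_bool (a = c) - h l * Q a c) / h l\<bar> < \<delta> / 2"
        by (simp add: dist_real_def diff_divide_distrib)
      with elim(1) show ?case by (simp add: abs_divide field_simps)
    qed
  qed
  have K_rate: "\<forall>\<^sub>F l in sequentially. of_bool (a = c) + h l * (Q a c - \<delta> / 2) \<le> K l a c"
    if "a \<in> W" "c \<in> W" for a c
  proof -
    have "(\<lambda>l. (Q a c - \<delta> / 4) / (h l * N l)) \<longlonglongrightarrow> (Q a c - \<delta> / 4) / 1"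
      by (intro tendsto_intros hN) auto
    then have "\<forall>\<^sub>F l in sequentially. Q a c - \<delta> / 2 < (Q a c - \<delta> / 4) / (h l * N l)"
      by (rule order_tendstoD) (use \<delta> in simp)
    moreover have "\<forall>\<^sub>F l in sequentially. of_bool (a = c) + (Q a c - \<delta> / 4) / N l \<le> K l a c"
      by (rule K[OF that]) (use \<delta> in simp)
    ultimately show ?thesis using hpos
    proof eventually_elim
      case (elim l)
      have "h l * (Q a c - \<delta> / 2) \<le> h l * ((Q a c - \<delta> / 4) / (h l * N l))"
        using elim by (intro mult_left_mono) auto
      also have "\<dots> = (Q a c - \<delta> / 4) / N l" using elim(3) by simp
      finally show ?case using elim(2) by simp
    qed
  qed
  have ball: "\<forall>\<^sub>F l in sequentially. \<forall>a\<in>W. \<forall>c\<in>W. 0 \<le> K l a c \<and>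
      \<bar>p (h l) a c - of_bool (a = c) - h l * Q a c\<bar> \<le> h l * (\<delta> / 2) \<and>
      of_bool (a = c) + h l * (Q a c - \<delta> / 2) \<le> K l a c"
    unfolding eventually_ball_finite_distrib[OF W]
    by (intro ballI eventually_conj K0 p_rate K_rate)
  from this hpos mpos show ?thesis
  proof eventually_elim
    case (elim l)
    have hl: "0 \<le> h l" using elim(2) by simp
    define \<eta> where "\<eta> = h l * (\<kappa> + w * \<delta>)"
    have "p (real (m l) * h l) a b \<le> (restricted_step W (K l) ^^ m l) (indicator {b}) a + (1 - f a)
        + real (m l) * (\<eta> + real (card W) * (h l * \<delta>))"
    proof (rule transition_function_le_restricted_iterate[OF p(1) hl W])
      show "0 \<le> K l a c" if "a \<in> W" "c \<in> W" for a c using elim(1) that by blast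
      show "p (h l) a c \<le> K l a c + h l * \<delta>" if "a \<in> W" "c \<in> W" for a c
      proof -
        have "\<bar>p (h l) a c - of_bool (a = c) - h l * Q a c\<bar> \<le> h l * (\<delta> / 2)"
          "of_bool (a = c) + h l * (Q a c - \<delta> / 2) \<le> K l a c"
          using elim(1) that by blast+
        then have "p (h l) a c - of_bool (a = c) - h l * Q a c \<le> h l * (\<delta> / 2)"
          "of_bool (a = c) + h l * Q a c \<le> K l a c + h l * (\<delta> / 2)"
          by (simp_all only: abs_le_iff) (simp add: algebra_simps)
        then show ?thesis by simp
      qed
      show "f a - \<eta> \<le> restricted_step W (p (h l)) f a" if aW: "a \<in> W" for a
      proof -
        have "f a - \<eta> \<le> f a + h l * (\<Sum>c\<in>W. Q a c * f c) - h l * (w * \<delta>)"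
          using mult_left_mono[OF drift[OF aW] hl] by (simp add: \<eta>_def algebra_simps)
        also have "\<dots> = (\<Sum>c\<in>W. of_bool (a = c) * f c + h l * (Q a c * f c) - h l * \<delta>)"
          using aW W by (simp add: sum.distrib sum_subtractf sum_distrib_left w_def of_bool_def
              if_distrib[of "\<lambda>x. x * _"] cong: if_cong)
        also have "\<dots> \<le> (\<Sum>c\<in>W. p (h l) a c * f c)"
        proof (rule sum_mono)
          fix c assume c: "c \<in> W"
          have "\<bar>p (h l) a c - of_bool (a = c) - h l * Q a c\<bar> \<le> h l * (\<delta> / 2)"
            using elim(1) aW c by blast
          then have "of_bool (a = c) + h l * Q a c - h l * (\<delta> / 2) \<le> p (h l) a c"
            by (simp only: abs_le_iff) linarith
          from mult_right_mono[OF this f(1)[OF c]]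
          have "of_bool (a = c) * f c + h l * (Q a c * f c) - h l * (\<delta> / 2) * f c \<le> p (h l) a c * f c"
            by (simp add: algebra_simps)
          moreover have "h l * (\<delta> / 2) * f c \<le> h l * (\<delta> / 2)"
            using hl \<delta> f[OF c] by (intro mult_left_le) auto
          moreover have "h l * (\<delta> / 2) \<le> h l * \<delta>" using hl \<delta> by simp
          ultimately show "of_bool (a = c) * f c + h l * (Q a c * f c) - h l * \<delta> \<le> p (h l) a c * f c"
            by linarith
        qed
        finally show ?thesis by (simp add: restricted_step_def)
      qed
      show "0 \<le> \<eta>" using hl \<kappa> w \<delta> by (simp add: \<eta>_def)
    qed (use f hl \<delta> a in auto)
    moreover have mh: "real (m l) * h l = s" using elim(3) by (simp add: h_def)
    moreover have "real (m l) * (\<eta> + real (card W) * (h l * \<delta>)) = (real (m l) * h l) * (\<kappa> + 2 * w * \<delta>)"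
      by (simp add: \<eta>_def w_def algebra_simps)
    ultimately have "p s a b \<le> (restricted_step W (K l) ^^ m l) (indicator {b}) a + (1 - f a) + s * (\<kappa> + 2 * w * \<delta>)"
      by simp
    with s\<delta> show ?case by (simp add: algebra_simps)
  qed
qed

section \<open>Markov chains on a finite set\<close>

text \<open>Events determined by the first \<open>m + 1\<close> states, expressed by saturation: an event that contains one outcome
  contains all outcomes with the same initial path. For finitely many states this yields measurability.\<close>

definition past_event :: "'a measure \<Rightarrow> (nat \<Rightarrow> 'a \<Rightarrow> 's) \<Rightarrow> nat \<Rightarrow> 'a set \<Rightarrow> bool" where
  "past_event M X m E \<longleftrightarrow> E \<subseteq> space M \<and>
     (\<forall>\<omega>\<in>E. \<forall>\<omega>'\<in>space M. (\<forall>i\<le>m. X i \<omega>' = X i \<omega>) \<longrightarrow> \<omega>' \<in> E)"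

definition cylinder :: "'a measure \<Rightarrow> (nat \<Rightarrow> 'a \<Rightarrow> 's) \<Rightarrow> nat \<Rightarrow> (nat \<Rightarrow> 's) \<Rightarrow> 'a set" where
  "cylinder M X m x = {\<omega> \<in> space M. \<forall>i\<le>m. X i \<omega> = x i}"

lemma past_event_restrict:
  assumes "past_event M X m E" "m \<le> m'" "k \<le> m'"
  shows "past_event M X m' {\<omega> \<in> E. X k \<omega> = a}"
  unfolding past_event_def
proof (intro conjI ballI impI)
  fix \<omega> \<omega>' assume \<omega>: "\<omega> \<in> {\<omega> \<in> E. X k \<omega> = a}" "\<omega>' \<in> space M" "\<forall>i\<le>m'. X i \<omega>' = X i \<omega>"
  have "\<forall>i\<le>m. X i \<omega>' = X i \<omega>" using \<omega>(3) assms(2) by (meson order_trans)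
  with \<omega> assms show "\<omega>' \<in> {\<omega> \<in> E. X k \<omega> = a}" unfolding past_event_def by auto
qed (use assms in \<open>auto simp: past_event_def\<close>)

context
  fixes M :: "'a measure" and S :: "'s set" and P :: "'s \<Rightarrow> 's \<Rightarrow> real" and X :: "nat \<Rightarrow> 'a \<Rightarrow> 's"
  assumes chain: "markov_chain M S P X" and S: "finite S"
begin

interpretation prob_space M
  using chain by (simp add: markov_chain_def)

lemma chain_state: "\<omega> \<in> space M \<Longrightarrow> X i \<omega> \<in> S"
  using chain measurable_space[of "X i" M "count_space S"] by (auto simp: markov_chain_def)

lemma chain_eq_sets: "{\<omega> \<in> space M. X i \<omega> = a} \<in> sets M"
proof -
  have "X i -` ({a} \<inter> S) \<inter> space M \<in> sets M"
    by (rule measurable_sets[of _ _ "count_space S"]) (use chain in \<open>auto simp: markov_chain_def\<close>)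
  also have "X i -` ({a} \<inter> S) \<inter> space M = {\<omega> \<in> space M. X i \<omega> = a}"
    using chain_state by auto
  finally show ?thesis .
qed

lemma cylinder_sets: "cylinder M X m x \<in> sets M"
  unfolding cylinder_def by (intro sets.sets_Collect_countable_All sets.sets_Collect_imp chain_eq_sets
      sets.sets_Collect_const)

text \<open>The transition probabilities are prescribed only after histories of positive probability; after a
  null history both sides vanish.\<close>

lemma measure_cylinder_Suc:
  assumes "\<forall>i\<le>Suc m. x i \<in> S"
  shows "measure M (cylinder M X (Suc m) x) = measure M (cylinder M X m x) * P (x m) (x (Suc m))"
proof (cases "measure M (cylinder M X m x) > 0")
  case True
  then have "cond_prob M (\<lambda>\<omega>. X (Suc m) \<omega> = x (Suc m)) (\<lambda>\<omega>. \<forall>i\<le>m. X i \<omega> = x i)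
      = P (x m) (x (Suc m))"
    using chain assms unfolding markov_chain_def cylinder_def by blast
  moreover have "{\<omega> \<in> space M. X (Suc m) \<omega> = x (Suc m) \<and> (\<forall>i\<le>m. X i \<omega> = x i)}
      = cylinder M X (Suc m) x"
    unfolding cylinder_def by (auto simp: le_Suc_eq)
  ultimately show ?thesis
    using True unfolding cond_prob_def cylinder_def by (simp add: field_simps)
next
  case False
  then have "measure M (cylinder M X m x) = 0" by (simp add: zero_less_measure_iff)
  moreover have "measure M (cylinder M X (Suc m) x) \<le> measure M (cylinder M X m x)"
    by (intro finite_measure_mono cylinder_sets) (auto simp: cylinder_def)
  ultimately show ?thesis by (simp add: measure_le_0_iff)
qed

lemma past_event_eq_Union_cylinder:
  assumes "past_event M X m E"
  shows "E = (\<Union>x\<in>{x \<in> {..m} \<rightarrow>\<^sub>E S. cylinder M X m x \<subseteq> E}. cylinder M X m x)"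
proof (intro equalityI subsetI)
  fix \<omega> assume \<omega>: "\<omega> \<in> E"
  then have sp: "\<omega> \<in> space M" using assms by (auto simp: past_event_def)
  let ?x = "restrict (\<lambda>i. X i \<omega>) {..m}"
  have "?x \<in> {..m} \<rightarrow>\<^sub>E S" using chain_state[OF sp] by auto
  moreover have "cylinder M X m ?x \<subseteq> E"
    using assms \<omega> by (auto simp: past_event_def cylinder_def)
  moreover have "\<omega> \<in> cylinder M X m ?x" using sp by (simp add: cylinder_def)
  ultimately show "\<omega> \<in> (\<Union>x\<in>{x \<in> {..m} \<rightarrow>\<^sub>E S. cylinder M X m x \<subseteq> E}. cylinder M X m x)"
    by blast
qed auto

lemma finite_paths: "finite ({..m::nat} \<rightarrow>\<^sub>E S)"
  using S by (intro finite_PiE) auto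

lemma past_event_sets:
  assumes "past_event M X m E"
  shows "E \<in> sets M"
  by (subst past_event_eq_Union_cylinder[OF assms])
    (intro sets.finite_UN cylinder_sets, use finite_paths[of m] in auto)

lemma disjoint_cylinders: "disjoint_family_on (cylinder M X m) ({..m} \<rightarrow>\<^sub>E S)"
  unfolding disjoint_family_on_def
proof (intro ballI impI)
  fix x y assume "x \<in> {..m} \<rightarrow>\<^sub>E S" "y \<in> {..m} \<rightarrow>\<^sub>E S" "x \<noteq> y"
  then obtain i where "i \<le> m" "x i \<noteq> y i"
    by (metis PiE_ext atMost_iff)
  then show "cylinder M X m x \<inter> cylinder M X m y = {}" by (auto simp: cylinder_def)
qed

lemma markov_property:
  assumes E: "past_event M X m E" and b: "b \<in> S"
  shows "measure M {\<omega> \<in> E. X m \<omega> = a \<and> X (Suc m) \<omega> = b} = measure M {\<omega> \<in> E. X m \<omega> = a} * P a b"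
proof -
  define E' where "E' = {\<omega> \<in> E. X m \<omega> = a}"
  have E': "past_event M X m E'"
    unfolding E'_def by (rule past_event_restrict[OF E]) auto
  define I where "I = {x \<in> {..m} \<rightarrow>\<^sub>E S. x m = a \<and> cylinder M X m x \<subseteq> E'}"
  define y where "y x = x(Suc m := b)" for x :: "nat \<Rightarrow> 's"
  have I: "finite I" unfolding I_def by (rule finite_subset[OF _ finite_paths[of m]]) auto
  have cyl_y: "cylinder M X (Suc m) (y x) = cylinder M X m x \<inter> {\<omega>. X (Suc m) \<omega> = b}" for x
    unfolding cylinder_def y_def by (auto simp: le_Suc_eq)
  have disj: "disjoint_family_on (cylinder M X m) I"
    by (rule disjoint_family_on_mono[OF _ disjoint_cylinders]) (auto simp: I_def)
  then have disj': "disjoint_family_on (\<lambda>x. cylinder M X (Suc m) (y x)) I"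
    unfolding disjoint_family_on_def cyl_y by blast
  have U: "E' = (\<Union>x\<in>I. cylinder M X m x)"
  proof
    show "E' \<subseteq> (\<Union>x\<in>I. cylinder M X m x)"
    proof
      fix \<omega> assume \<omega>: "\<omega> \<in> E'"
      then obtain x where x: "x \<in> {..m} \<rightarrow>\<^sub>E S" "cylinder M X m x \<subseteq> E'" "\<omega> \<in> cylinder M X m x"
        using past_event_eq_Union_cylinder[OF E'] by blast
      moreover have "x m = a" using x(3) \<omega> by (auto simp: cylinder_def E'_def)
      ultimately show "\<omega> \<in> (\<Union>x\<in>I. cylinder M X m x)" by (auto simp: I_def)
    qed
  qed (auto simp: I_def)
  have "{\<omega> \<in> E. X m \<omega> = a \<and> X (Suc m) \<omega> = b} = E' \<inter> {\<omega>. X (Suc m) \<omega> = b}"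
    by (auto simp: E'_def)
  also have "\<dots> = (\<Union>x\<in>I. cylinder M X (Suc m) (y x))"
    unfolding U cyl_y by blast
  also have "measure M \<dots> = (\<Sum>x\<in>I. measure M (cylinder M X (Suc m) (y x)))"
    by (rule finite_measure_finite_Union[OF I _ disj']) (use cylinder_sets in auto)
  also have "\<dots> = (\<Sum>x\<in>I. measure M (cylinder M X m x) * P a b)"
  proof (rule sum.cong)
    fix x assume x: "x \<in> I"
    then have "\<forall>i\<le>Suc m. y x i \<in> S" using b by (auto simp: y_def I_def)
    moreover have "y x m = a" "y x (Suc m) = b" using x by (auto simp: y_def I_def)
    ultimately have "measure M (cylinder M X (Suc m) (y x)) = measure M (cylinder M X m (y x)) * P a b"
      using measure_cylinder_Suc[of m "y x"] by simp
    also have "cylinder M X m (y x) = cylinder M X m x"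
      by (auto simp: cylinder_def y_def)
    finally show "measure M (cylinder M X (Suc m) (y x)) = measure M (cylinder M X m x) * P a b" .
  qed simp
  also have "\<dots> = measure M (\<Union>x\<in>I. cylinder M X m x) * P a b"
    by (subst finite_measure_finite_Union[OF I _ disj])
      (use cylinder_sets in \<open>auto simp: sum_distrib_right\<close>)
  finally show ?thesis by (simp add: U[symmetric] E'_def)
qed

lemma sum_measure_state_le:
  assumes "E \<in> sets M" "finite W" "inj_on g W"
  shows "(\<Sum>c\<in>W. measure M {\<omega> \<in> E. X k \<omega> = g c}) \<le> measure M E"
proof -
  have m: "{\<omega> \<in> E. X k \<omega> = c} \<in> sets M" for c
  proof -
    have "{\<omega> \<in> E. X k \<omega> = c} = E \<inter> {\<omega> \<in> space M. X k \<omega> = c}"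
      using sets.sets_into_space[OF assms(1)] by auto
    then show ?thesis using sets.Int[OF assms(1) chain_eq_sets] by simp
  qed
  have "(\<Sum>c\<in>W. measure M {\<omega> \<in> E. X k \<omega> = g c}) = measure M (\<Union>c\<in>W. {\<omega> \<in> E. X k \<omega> = g c})"
    by (rule finite_measure_finite_Union[symmetric])
      (use assms m in \<open>auto simp: disjoint_family_on_def inj_on_def\<close>)
  also have "\<dots> \<le> measure M E"
    by (rule finite_measure_mono) (use assms in auto)
  finally show ?thesis .
qed

lemma markov_property_two_step:
  assumes E: "past_event M X m E" and b: "b \<in> S"
  shows "measure M {\<omega> \<in> E. X m \<omega> = a} * (\<Sum>r\<in>S. P a r * P r b)
    \<le> measure M {\<omega> \<in> E. X m \<omega> = a \<and> X (Suc (Suc m)) \<omega> = b}"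
proof -
  define E' where "E' = {\<omega> \<in> E. X m \<omega> = a}"
  have E': "past_event M X (Suc m) E'"
    unfolding E'_def by (rule past_event_restrict[OF E]) auto
  have "measure M E' * (\<Sum>r\<in>S. P a r * P r b) = (\<Sum>r\<in>S. measure M E' * P a r * P r b)"
    by (simp add: sum_distrib_left mult.assoc)
  also have "\<dots> = (\<Sum>r\<in>S. measure M {\<omega> \<in> {\<omega> \<in> E'. X (Suc (Suc m)) \<omega> = b}. X (Suc m) \<omega> = r})"
  proof (rule sum.cong)
    fix r assume r: "r \<in> S"
    have "measure M E' * P a r * P r b = measure M {\<omega> \<in> E'. X (Suc m) \<omega> = r} * P r b"
      unfolding E'_def by (simp add: markov_property[OF E r, symmetric] conj_ac)
    also have "\<dots> = measure M {\<omega> \<in> E'. X (Suc m) \<omega> = r \<and> X (Suc (Suc m)) \<omega> = b}"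
      by (rule markov_property[OF E' b, symmetric])
    finally show "measure M E' * P a r * P r b
        = measure M {\<omega> \<in> {\<omega> \<in> E'. X (Suc (Suc m)) \<omega> = b}. X (Suc m) \<omega> = r}"
      by (simp add: conj_ac)
  qed simp
  also have "\<dots> \<le> measure M {\<omega> \<in> E'. X (Suc (Suc m)) \<omega> = b}"
    using past_event_restrict[OF E', of "Suc (Suc m)" "Suc (Suc m)" b] S
    by (intro sum_measure_state_le[where g = "\<lambda>r. r"] past_event_sets) auto
  finally show ?thesis by (simp add: E'_def conj_ac)
qed

text \<open>Only the paths that at even times stay in the window are counted. The labelling \<open>g\<close> serves to express the kernel
  in a coordinate other than that of the chain.\<close>

lemma markov_iterate_lower_bound:
  assumes W: "finite W" "inj_on g W" "g ` W \<subseteq> S"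
    and K: "\<And>a c. a \<in> W \<Longrightarrow> c \<in> W \<Longrightarrow> K a c = (\<Sum>r\<in>S. P (g a) r * P r (g c))"
    and K0: "\<And>a c. a \<in> W \<Longrightarrow> c \<in> W \<Longrightarrow> 0 \<le> K a c"
    and E: "past_event M X m E" and a: "a \<in> W"
  shows "measure M {\<omega> \<in> E. X m \<omega> = g a} * (restricted_step W K ^^ k) (indicator {b}) a
    \<le> measure M {\<omega> \<in> E. X m \<omega> = g a \<and> X (m + 2 * k) \<omega> = g b}"
  using E a
proof (induction k arbitrary: m E a)
  case 0
  then show ?case by (auto simp: indicator_def)
next
  case (Suc k)
  define v where "v = (restricted_step W K ^^ k) (indicator {b})"
  define E' where "E' = {\<omega> \<in> E. X m \<omega> = g a}"
  have v0: "0 \<le> v c" if "c \<in> W" for c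
    unfolding v_def by (rule restricted_step_funpow_nonneg) (use K0 that in auto)
  have E': "past_event M X (Suc (Suc m)) E'"
    unfolding E'_def by (rule past_event_restrict[OF Suc.prems(1)]) auto
  have Es: "{\<omega> \<in> E'. X (m + 2 * Suc k) \<omega> = g b} \<in> sets M"
    by (rule past_event_sets[OF past_event_restrict[OF E', of "m + 2 * Suc k"]]) auto
  have "measure M E' * (restricted_step W K ^^ Suc k) (indicator {b}) a
      = (\<Sum>c\<in>W. measure M E' * K a c * v c)"
    by (simp add: restricted_step_def v_def sum_distrib_left mult.assoc)
  also have "\<dots> \<le> (\<Sum>c\<in>W. measure M {\<omega> \<in> {\<omega> \<in> E'. X (m + 2 * Suc k) \<omega> = g b}. X (Suc (Suc m)) \<omega> = g c})"
  proof (rule sum_mono)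
    fix c assume c: "c \<in> W"
    then have gc: "g c \<in> S" using W by auto
    have "measure M E' * K a c \<le> measure M {\<omega> \<in> E'. X (Suc (Suc m)) \<omega> = g c}"
      using markov_property_two_step[OF Suc.prems(1) gc, of "g a"] K[OF Suc.prems(2) c]
      by (simp add: E'_def conj_ac)
    then have "measure M E' * K a c * v c \<le> measure M {\<omega> \<in> E'. X (Suc (Suc m)) \<omega> = g c} * v c"
      by (rule mult_right_mono) (rule v0[OF c])
    also have "\<dots> \<le> measure M {\<omega> \<in> E'. X (Suc (Suc m)) \<omega> = g c \<and> X (Suc (Suc m) + 2 * k) \<omega> = g b}"
      unfolding v_def by (rule Suc.IH[OF E' c])
    finally show "measure M E' * K a c * v c
        \<le> measure M {\<omega> \<in> {\<omega> \<in> E'. X (m + 2 * Suc k) \<omega> = g b}. X (Suc (Suc m)) \<omega> = g c}"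
      by (simp add: conj_ac)
  qed
  also have "\<dots> \<le> measure M {\<omega> \<in> E'. X (m + 2 * Suc k) \<omega> = g b}"
    by (rule sum_measure_state_le[OF Es W(1,2)])
  finally show ?case by (simp add: E'_def conj_ac)
qed

end

section \<open>Escape from a window\<close>

text \<open>The function vanishes at \<open>\<plusminus> (R + 1)\<close>, so that the sum over the window is the full generator.
  Away from 0 the chain moves towards 0 at the larger of its two rates, and only \<open>a = 0\<close> contributes a
  loss: there both jumps, each of rate 1, increase \<open>\<bar>a\<bar>\<close>.\<close>

lemma Q_Z_drift:
  assumes "2 \<le> q" "\<bar>a\<bar> \<le> int R"
  shows "- (2 / (real R + 1)) \<le> (\<Sum>c\<in>{- int R..int R}. Q_Z q a c * (1 - \<bar>real_of_int c\<bar> / (real R + 1)))"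
proof -
  define f where "f c = 1 - \<bar>real_of_int c\<bar> / (real R + 1)" for c
  have "(\<Sum>c\<in>{- int R..int R}. Q_Z q a c * f c) = (\<Sum>c\<in>{a - 1, a, a + 1}. Q_Z q a c * f c)"
  proof (rule sum.mono_neutral_cong)
    fix c assume c: "c \<in> {a - 1, a, a + 1} - {- int R..int R}"
    then have "\<bar>c\<bar> = int R + 1" using assms(2) by auto
    then have "\<bar>real_of_int c\<bar> = real R + 1" by linarith
    then show "Q_Z q a c * f c = 0" by (simp add: f_def)
  qed (auto simp: Q_Z_def)
  also have "\<dots> = real q powi a * (f (a - 1) - f a) + real q powi (- a) * (f (a + 1) - f a)"
    by (simp add: Q_Z_def algebra_simps)
  also have "\<dots> \<ge> - (2 / (real R + 1))"
  proof (cases "a = 0")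
    case True
    then show ?thesis by (simp add: f_def)
  next
    case False
    have mono: "real q powi i \<le> real q powi j" if "i \<le> j" for i j
      using assms that by (intro power_int_increasing) auto
    have "f (a - 1) - f a = (if a > 0 then 1 else -1) / (real R + 1)"
      "f (a + 1) - f a = (if a > 0 then -1 else 1) / (real R + 1)"
      using False by (auto simp: f_def simp flip: diff_divide_distrib)
    then have "0 \<le> real q powi a * (f (a - 1) - f a) + real q powi (- a) * (f (a + 1) - f a)"
      using mono[of a "- a"] mono[of "- a" a] False
      by (auto simp: simp flip: diff_divide_distrib add_divide_distrib)
    moreover have "- (2 / (real R + 1)) \<le> 0" by simp
    ultimately show ?thesis by linarith
  qed
  finally show ?thesis by (simp add: f_def)
qed

text \<open>The window is chosen so that the escape bound \<open>(\<bar>a\<bar> + 2 * s) / (R + 1)\<close> is at most \<open>\<epsilon> / 2\<close>.\<close>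

proposition two_step_iterate_lower_limit:
  fixes m :: "nat \<Rightarrow> nat"
  assumes q: "2 \<le> q" and p: "transition_function p" "has_rates p (Q_Z q)" and s: "0 < s"
    and m: "(\<lambda>l. real (m l) / time_scale q l) \<longlonglongrightarrow> s" and \<epsilon>: "0 < \<epsilon>"
  obtains R :: nat where "\<bar>a\<bar> \<le> int R" "\<forall>\<^sub>F l in sequentially.
    p s a b - \<epsilon> \<le> (restricted_step {- int R..int R} (two_step q l) ^^ m l) (indicator {b}) a"
proof -
  obtain R :: nat where R: "(\<bar>real_of_int a\<bar> + 2 * s) / (\<epsilon> / 2) + \<bar>real_of_int a\<bar> \<le> real R"
    using real_arch_simple by blast
  have "0 \<le> (\<bar>real_of_int a\<bar> + 2 * s) / (\<epsilon> / 2)" using s \<epsilon> by simp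
  with R have aR: "\<bar>a\<bar> \<le> int R" and R': "(\<bar>real_of_int a\<bar> + 2 * s) / (\<epsilon> / 2) \<le> real R + 1"
    by linarith+
  define f where "f c = 1 - \<bar>real_of_int c\<bar> / (real R + 1)" for c
  have f: "0 \<le> f c \<and> f c \<le> 1" if "c \<in> {- int R..int R}" for c
  proof -
    have "\<bar>real_of_int c\<bar> \<le> real R + 1" using that by auto
    then show ?thesis by (simp add: f_def)
  qed
  have "\<forall>\<^sub>F l in sequentially. p s a b
    \<le> (restricted_step {- int R..int R} (two_step q l) ^^ m l) (indicator {b}) a
        + (1 - f a) + s * (2 / (real R + 1)) + \<epsilon> / 2"
  proof (rule restricted_iterate_lower_limit[OF p _ s time_scale_at_top[OF q] m])
    show "- (2 / (real R + 1)) \<le> (\<Sum>c\<in>{- int R..int R}. Q_Z q a c * f c)" if "a \<in> {- int R..int R}" for a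
      unfolding f_def by (rule Q_Z_drift[OF q]) (use that in auto)
  qed (use f \<epsilon> aR two_step_nonneg[OF q] two_step_rates[OF q] in auto)
  then have "\<forall>\<^sub>F l in sequentially. p s a b - \<epsilon>
      \<le> (restricted_step {- int R..int R} (two_step q l) ^^ m l) (indicator {b}) a"
  proof eventually_elim
    case (elim l)
    have "(1 - f a) + s * (2 / (real R + 1)) = (\<bar>real_of_int a\<bar> + 2 * s) / (real R + 1)"
    by (simp add: f_def add_divide_distrib)
    also have "\<dots> \<le> \<epsilon> / 2" using R' \<epsilon> by (simp add: field_simps)
    finally show ?case using elim by linarith
  qed
  with aR show ?thesis by (rule that)
qed

section \<open>Total variation and point masses\<close>

text \<open>Scheffe's lemma with a one-sided hypothesis. A finite set carries almost all of \<open>\<nu>\<close>, hence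
  \<open>\<nu> B - \<mu> B\<close> is small from above for every \<open>B\<close>; since both measures have total mass one,
  passing to the complement of \<open>B\<close> gives the other sign.\<close>

lemma tv_dist_tendsto_zero:
  fixes \<mu> :: "nat \<Rightarrow> 'c::countable measure"
  assumes \<nu>: "prob_space \<nu>" "sets \<nu> = UNIV"
    and \<mu>: "\<forall>\<^sub>F l in sequentially. prob_space (\<mu> l)" "\<And>l. sets (\<mu> l) = UNIV"
    and lim: "\<And>x \<epsilon>. 0 < \<epsilon> \<Longrightarrow> \<forall>\<^sub>F l in sequentially. measure \<nu> {x} - \<epsilon> \<le> measure (\<mu> l) {x}"
  shows "(\<lambda>l. tv_dist (\<mu> l) \<nu>) \<longlonglongrightarrow> 0"
proof (rule tendstoI)
  fix \<epsilon> :: real assume \<epsilon>: "0 < \<epsilon>"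
  interpret N: prob_space \<nu> by fact
  have space_\<nu>: "space \<nu> = UNIV"
    using sets.sets_into_space[of UNIV \<nu>] \<nu> by auto
  define A where "A k = {x :: 'c. to_nat x \<le> k}" for k
  have fin: "finite (A k)" for k
    unfolding A_def by (rule finite_imageD[of to_nat]) (auto intro: finite_subset[of _ "{..k}"] inj_on_subset[OF inj_to_nat])
  have "(\<lambda>k. measure \<nu> (A k)) \<longlonglongrightarrow> measure \<nu> (\<Union>k. A k)"
    by (rule N.finite_Lim_measure_incseq) (auto simp: \<nu> incseq_def A_def)
  also have "(\<Union>k. A k) = space \<nu>" by (auto simp: A_def space_\<nu>)
  finally have "\<forall>\<^sub>F k in sequentially. 1 - \<epsilon> / 4 < measure \<nu> (A k)"
    by (rule order_tendstoD) (use \<epsilon> in \<open>simp add: N.prob_space\<close>)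
  then obtain k where k: "1 - \<epsilon> / 4 < measure \<nu> (A k)"
    by (auto simp: eventually_sequentially)
  define \<eta> where "\<eta> = \<epsilon> / (4 * (real (card (A k)) + 1))"
  have \<eta>: "0 < \<eta>" using \<epsilon> by (simp add: \<eta>_def)
  have card_\<eta>: "real (card (A k)) * \<eta> \<le> \<epsilon> / 4"
    using \<epsilon> by (simp add: \<eta>_def field_simps)
  have "\<forall>\<^sub>F l in sequentially. \<forall>x\<in>A k. measure \<nu> {x} - \<eta> \<le> measure (\<mu> l) {x}"
    unfolding eventually_ball_finite_distrib[OF fin] using lim[OF \<eta>] by blast
  with \<mu>(1) show "\<forall>\<^sub>F l in sequentially. dist (tv_dist (\<mu> l) \<nu>) 0 < \<epsilon>"
  proof eventually_elim
    case (elim l)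
    interpret M: prob_space "\<mu> l" by (rule elim(1))
    have space_\<mu>: "space (\<mu> l) = UNIV"
      using sets.sets_into_space[of UNIV "\<mu> l"] \<mu> by auto
    have one_sided: "measure \<nu> B - measure (\<mu> l) B \<le> \<epsilon> / 2" for B
    proof -
      have "measure \<nu> B \<le> measure \<nu> (B \<inter> A k) + measure \<nu> (space \<nu> - A k)"
        using N.finite_measure_mono[of B "(B \<inter> A k) \<union> (space \<nu> - A k)"]
          measure_Un_le[of "B \<inter> A k" \<nu> "space \<nu> - A k"]
        by (force simp: \<nu> space_\<nu>)
      also have "measure \<nu> (space \<nu> - A k) = 1 - measure \<nu> (A k)"
        by (rule N.prob_compl) (simp add: \<nu>)
      also have "measure \<nu> (B \<inter> A k) = (\<Sum>x\<in>B \<inter> A k. measure \<nu> {x})"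
        by (rule N.finite_measure_eq_sum_singleton) (use fin in \<open>auto simp: \<nu>\<close>)
      also have "\<dots> \<le> (\<Sum>x\<in>B \<inter> A k. measure (\<mu> l) {x} + \<eta>)"
        by (rule sum_mono) (use elim(2) in force)
      also have "\<dots> = (\<Sum>x\<in>B \<inter> A k. measure (\<mu> l) {x}) + real (card (B \<inter> A k)) * \<eta>"
        by (simp add: sum.distrib)
      also have "(\<Sum>x\<in>B \<inter> A k. measure (\<mu> l) {x}) = measure (\<mu> l) (B \<inter> A k)"
        by (rule M.finite_measure_eq_sum_singleton[symmetric]) (use fin in \<open>auto simp: \<mu>\<close>)
      also have "measure (\<mu> l) (B \<inter> A k) \<le> measure (\<mu> l) B"
        by (rule M.finite_measure_mono) (auto simp: \<mu>)
      also have "real (card (B \<inter> A k)) * \<eta> \<le> real (card (A k)) * \<eta>"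
        using \<eta> card_mono[OF fin, of "B \<inter> A k" k] by (intro mult_right_mono) auto
      finally show ?thesis using card_\<eta> k by linarith
    qed
    have two_sided: "\<bar>measure (\<mu> l) B - measure \<nu> B\<bar> \<le> \<epsilon> / 2" for B
    proof -
      have "measure \<nu> (- B) = 1 - measure \<nu> B" "measure (\<mu> l) (- B) = 1 - measure (\<mu> l) B"
        using N.prob_compl[of B] M.prob_compl[of B]
        by (simp_all add: space_\<nu> space_\<mu> \<mu> \<nu> Compl_eq_Diff_UNIV)
      then show ?thesis using one_sided[of B] one_sided[of "- B"] by linarith
    qed
    have "tv_dist (\<mu> l) \<nu> \<le> \<epsilon> / 2"
      unfolding tv_dist_def by (rule cSUP_least) (use two_sided in \<open>auto simp: \<mu>\<close>)
    moreover have "\<bar>measure (\<mu> l) {} - measure \<nu> {}\<bar> \<le> tv_dist (\<mu> l) \<nu>"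
      unfolding tv_dist_def
      by (rule cSUP_upper[where x = "{}" and f = "\<lambda>B. \<bar>measure (\<mu> l) B - measure \<nu> B\<bar>"])
        (use two_sided in \<open>auto simp: \<mu> intro!: bdd_aboveI2[of _ _ "\<epsilon> / 2"]\<close>)
    ultimately show ?case using \<epsilon> by simp
  qed
qed

section \<open>The change of time scale\<close>

definition rescaled_time :: "nat \<Rightarrow> nat \<Rightarrow> real \<Rightarrow> nat" where
  "rescaled_time q l t = nat \<lfloor>time_scale q l * t\<rfloor>"

lemma Y_proc_eq_iff:
  assumes "- int l \<le> a"
  shows "Y_proc q (2 * l) X t \<omega> = a \<longleftrightarrow> X (2 * rescaled_time q l t) \<omega> = nat (int l + a)"
  using assms by (auto simp: Y_proc_def rescaled_time_def time_scale_def)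

lemma rescaled_time_mono:
  assumes "2 \<le> q" "t \<le> t'"
  shows "rescaled_time q l t \<le> rescaled_time q l t'"
  unfolding rescaled_time_def time_scale_def
  by (intro nat_mono floor_mono mult_left_mono) (use assms in auto)

lemma rescaled_time_tendsto:
  assumes q: "2 \<le> q" and t: "0 \<le> t"
  shows "(\<lambda>l. real (rescaled_time q l t) / time_scale q l) \<longlonglongrightarrow> t"
proof (rule tendsto_sandwich)
  have Npos: "0 < time_scale q l" for l using q by (simp add: time_scale_def)
  have r: "real (rescaled_time q l t) = of_int \<lfloor>time_scale q l * t\<rfloor>" for l
    using Npos[of l] t by (simp add: rescaled_time_def)
  have "t - 1 / time_scale q l = (time_scale q l * t - 1) / time_scale q l" for l
    using Npos[of l] by (simp add: field_simps)
  moreover have "time_scale q l * t - 1 \<le> real (rescaled_time q l t)" for l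
    unfolding r by linarith
  ultimately show "\<forall>\<^sub>F l in sequentially. t - 1 / time_scale q l \<le> real (rescaled_time q l t) / time_scale q l"
    using Npos by (intro always_eventually allI) (simp add: divide_right_mono less_imp_le)
  show "\<forall>\<^sub>F l in sequentially. real (rescaled_time q l t) / time_scale q l \<le> t"
    using Npos by (intro always_eventually allI) (simp add: r divide_le_eq mult.commute)
  have "(\<lambda>l. 1 / time_scale q l) \<longlonglongrightarrow> 0"
    by (rule tendsto_divide_0[OF tendsto_const filterlim_at_top_imp_at_infinity[OF time_scale_at_top[OF q]]])
  from tendsto_diff[OF tendsto_const this]
  show "(\<lambda>l. t - 1 / time_scale q l) \<longlonglongrightarrow> t" by simp
qed auto

section \<open>Probabilities of finite paths\<close>

text \<open>The analogue of \<open>measure_cylinder_Suc\<close>, for a fixed sequence of times.\<close>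

lemma ct_markov_chain_path_Suc:
  assumes Z: "prob_space N" "\<forall>t\<ge>0. Z t \<in> measurable N (count_space (UNIV :: 's set))"
    and p: "measure N {\<omega> \<in> space N. \<forall>i\<le>m. Z (s i) \<omega> = x i} > 0 \<Longrightarrow>
      cond_prob N (\<lambda>\<omega>. Z (s (Suc m)) \<omega> = x (Suc m)) (\<lambda>\<omega>. \<forall>i\<le>m. Z (s i) \<omega> = x i) = c"
    and s: "\<forall>i\<le>m. 0 \<le> s i"
  shows "measure N {\<omega> \<in> space N. \<forall>i\<le>Suc m. Z (s i) \<omega> = x i}
    = measure N {\<omega> \<in> space N. \<forall>i\<le>m. Z (s i) \<omega> = x i} * c"
    (is "measure N ?G = measure N ?F * c")
proof -
  interpret prob_space N by fact
  have F: "?F \<in> sets N"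
  proof (intro sets.sets_Collect_countable_All)
    fix i
    show "{\<omega> \<in> space N. i \<le> m \<longrightarrow> Z (s i) \<omega> = x i} \<in> sets N"
    proof (cases "i \<le> m")
      case True
      then have "Z (s i) -` {x i} \<inter> space N \<in> sets N"
        using Z(2) s by (intro measurable_sets[of _ _ "count_space UNIV"]) auto
      also have "Z (s i) -` {x i} \<inter> space N = {\<omega> \<in> space N. i \<le> m \<longrightarrow> Z (s i) \<omega> = x i}"
        using True by auto
      finally show ?thesis .
    qed simp
  qed
  have G: "?G = {\<omega> \<in> space N. Z (s (Suc m)) \<omega> = x (Suc m) \<and> (\<forall>i\<le>m. Z (s i) \<omega> = x i)}"
    by (auto simp: le_Suc_eq)
  show ?thesis
  proof (cases "measure N ?F > 0")
    case True
    from p[OF this] True show ?thesis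
      unfolding cond_prob_def G by (simp add: field_simps)
  next
    case False
    then have "measure N ?F = 0" by (simp add: zero_less_measure_iff)
    moreover have "measure N ?G \<le> measure N ?F"
      by (intro finite_measure_mono F) auto
    ultimately show ?thesis by (simp add: measure_le_0_iff)
  qed
qed

text \<open>Needed because the lower bound \<open>P - \<eta>\<close> may be negative, when it cannot simply be multiplied.\<close>

lemma product_lower_bound:
  fixes G P e v \<eta> :: real
  assumes "G \<in> {0..1}" "P \<in> {0..1}" "0 \<le> e" "0 \<le> v" "G - \<eta> \<le> e" "P - \<eta> \<le> v" "0 \<le> \<eta>"
  shows "G * P - 2 * \<eta> \<le> e * v"
proof (cases "P \<le> \<eta>")
  case True
  have "G * P \<le> P" using assms by (simp add: mult_left_le_one_le)
  moreover have "0 \<le> e * v" using assms by simp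
  ultimately show ?thesis using True assms by linarith
next
  case False
  have "G * P - 2 * \<eta> \<le> (G - \<eta>) * (P - \<eta>)"
  proof -
    have "\<eta> * G \<le> \<eta>" "\<eta> * P \<le> \<eta>" using assms by (auto intro: mult_left_le)
    moreover have "0 \<le> \<eta> * \<eta>" by simp
    moreover have "(G - \<eta>) * (P - \<eta>) = G * P - \<eta> * G - \<eta> * P + \<eta> * \<eta>"
      by (simp add: algebra_simps)
    ultimately show ?thesis by linarith
  qed
  also have "\<dots> \<le> e * (P - \<eta>)" using assms False by (intro mult_right_mono) auto
  also have "\<dots> \<le> e * v" using assms by (intro mult_left_mono) auto
  finally show ?thesis .
qed

text \<open>Induction on the number of times. The event that \<open>Y\<close> follows \<open>x\<close> up to \<open>s k\<close> belongs to the past of the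
  step corresponding to \<open>s k\<close>, so the discrete Markov property multiplies its probability by at least
  the restricted iterate, which is eventually at least the transition probability of \<open>Z\<close> minus any
  prescribed error.\<close>

lemma path_probability_lower_limit:
  fixes M :: "nat \<Rightarrow> 'a measure" and X :: "nat \<Rightarrow> nat \<Rightarrow> 'a \<Rightarrow> nat" and Z :: "real \<Rightarrow> 'b \<Rightarrow> int"
    and s :: "nat \<Rightarrow> real" and x :: "nat \<Rightarrow> int"
  assumes q: "2 \<le> q"
    and X: "\<And>l. 0 < l \<Longrightarrow> markov_chain (M l) {0..2 * l} (P_mat q (2 * l)) (X l)"
    and Z: "ct_markov_chain N (Q_Z q) Z"
    and Z0: "AE \<omega> in N. Z 0 \<omega> = z0"
    and Y0: "\<forall>\<^sub>F l in sequentially. AE \<omega> in M l. Y_proc q (2 * l) (X l) 0 \<omega> = z0"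
    and s: "s 0 = 0" "\<forall>i<k. s i < s (Suc i)" and \<epsilon>: "0 < \<epsilon>"
  shows "\<forall>\<^sub>F l in sequentially. measure N {\<omega> \<in> space N. \<forall>i\<le>k. Z (s i) \<omega> = x i} - \<epsilon>
    \<le> measure (M l) {\<omega> \<in> space (M l). \<forall>i\<le>k. Y_proc q (2 * l) (X l) (s i) \<omega> = x i}"
  using s(2) \<epsilon>
proof (induction k arbitrary: \<epsilon>)
  case 0
  interpret N: prob_space N using Z by (simp add: ct_markov_chain_def)
  have pos: "\<forall>\<^sub>F l in sequentially. - x 0 \<le> int l \<and> 0 < l"
    using eventually_ge_at_top[of "nat (- x 0)"] eventually_gt_at_top[of 0]
    by eventually_elim auto
  from Y0 pos show ?case
  proof eventually_elim
    case (elim l)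
    interpret M: prob_space "M l" using X[of l] elim by (simp add: markov_chain_def)
    have sets: "{\<omega> \<in> space (M l). Y_proc q (2 * l) (X l) 0 \<omega> = x 0} \<in> sets (M l)"
      using chain_eq_sets[OF X[of l]] elim by (simp add: Y_proc_eq_iff)
    show ?case
    proof (cases "x 0 = z0")
      case True
      have "measure (M l) {\<omega> \<in> space (M l). Y_proc q (2 * l) (X l) 0 \<omega> = x 0} = 1"
        unfolding M.prob_eq_1[OF sets] using elim(1) True by auto
      then show ?thesis using 0 s(1) N.prob_le_1 by (smt (verit) Collect_cong le_zero_eq)
    next
      case False
      have "measure N {\<omega> \<in> space N. Z 0 \<omega> = x 0} = measure N {}"
      proof (rule measure_eq_AE)
        have "Z 0 -` {x 0} \<inter> space N \<in> sets N"
          using Z by (intro measurable_sets[of _ _ "count_space UNIV"]) (auto simp: ct_markov_chain_def)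
        also have "Z 0 -` {x 0} \<inter> space N = {\<omega> \<in> space N. Z 0 \<omega> = x 0}" by auto
        finally show "{\<omega> \<in> space N. Z 0 \<omega> = x 0} \<in> sets N" .
      qed (use Z0 False in auto)
      then have "measure N {\<omega> \<in> space N. \<forall>i\<le>0. Z (s i) \<omega> = x i} = 0" using s(1) by simp
      then show ?thesis using 0 measure_nonneg[of "M l"] by (smt (verit))
    qed
  qed
next
  case (Suc k)
  interpret N: prob_space N using Z by (simp add: ct_markov_chain_def)
  obtain p where p: "transition_function p" "has_rates p (Q_Z q)"
    and markov: "\<And>m s x. 0 \<le> s 0 \<Longrightarrow> (\<forall>i\<le>m. s i < s (Suc i)) \<Longrightarrow>
             measure N {\<omega> \<in> space N. \<forall>i\<le>m. Z (s i) \<omega> = x i} > 0 \<Longrightarrow>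
           cond_prob N (\<lambda>\<omega>. Z (s (Suc m)) \<omega> = x (Suc m)) (\<lambda>\<omega>. \<forall>i\<le>m. Z (s i) \<omega> = x i)
             = p (s (Suc m) - s m) (x m) (x (Suc m))"
    using Z unfolding ct_markov_chain_def by blast
  have mono: "s i \<le> s j" if "i \<le> j" "j \<le> Suc k" for i j
    using that(1,2)
  proof (induction j rule: dec_induct)
    case (step j)
    then have "s j < s (Suc j)" using Suc.prems(1) by auto
    with step show ?case by simp
  qed simp
  have s_nonneg: "0 \<le> s i" if "i \<le> Suc k" for i
    using mono[of 0 i] that s(1) by simp
  define F where "F = {\<omega> \<in> space N. \<forall>i\<le>k. Z (s i) \<omega> = x i}"
  define \<pi> where "\<pi> = p (s (Suc k) - s k) (x k) (x (Suc k))"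
  have step: "s k < s (Suc k)" using Suc.prems(1) by simp
  have \<pi>: "\<pi> \<in> {0..1}"
    using transition_functionD(1,3)[OF p(1), of "s (Suc k) - s k"] step by (simp add: \<pi>_def)
  have F_Suc: "measure N {\<omega> \<in> space N. \<forall>i\<le>Suc k. Z (s i) \<omega> = x i} = measure N F * \<pi>"
    unfolding F_def \<pi>_def
    by (rule ct_markov_chain_path_Suc)
      (use Z s_nonneg markov[of s k x] Suc.prems(1) s(1) in \<open>auto simp: ct_markov_chain_def\<close>)
  define m where "m l = rescaled_time q l (s (Suc k)) - rescaled_time q l (s k)" for l
  have le: "rescaled_time q l (s i) \<le> rescaled_time q l (s j)" if "i \<le> j" "j \<le> Suc k" for i j l
    by (rule rescaled_time_mono[OF q]) (rule mono[OF that])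
  have "(\<lambda>l. real (rescaled_time q l (s (Suc k))) / time_scale q l
      - real (rescaled_time q l (s k)) / time_scale q l) \<longlonglongrightarrow> s (Suc k) - s k"
    by (intro tendsto_diff rescaled_time_tendsto[OF q] s_nonneg) auto
  then have m: "(\<lambda>l. real (m l) / time_scale q l) \<longlonglongrightarrow> s (Suc k) - s k"
    using le[of k "Suc k"] by (simp add: m_def of_nat_diff diff_divide_distrib)
  have \<epsilon>2: "0 < \<epsilon> / 2" using Suc.prems by simp
  obtain R :: nat where R: "\<bar>x k\<bar> \<le> int R" and v: "\<forall>\<^sub>F l in sequentially. \<pi> - \<epsilon> / 2
      \<le> (restricted_step {- int R..int R} (two_step q l) ^^ m l) (indicator {x (Suc k)}) (x k)"
    unfolding \<pi>_def using two_step_iterate_lower_limit[OF q p _ m \<epsilon>2] step by auto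
  have IH: "\<forall>\<^sub>F l in sequentially. measure N F - \<epsilon> / 2
    \<le> measure (M l) {\<omega> \<in> space (M l). \<forall>i\<le>k. Y_proc q (2 * l) (X l) (s i) \<omega> = x i}"
    unfolding F_def by (rule Suc.IH) (use Suc.prems in auto)
  have large: "\<forall>\<^sub>F l in sequentially. int R \<le> int l \<and> \<bar>x (Suc k)\<bar> \<le> int l \<and> 0 < l"
    using eventually_ge_at_top[of R] eventually_ge_at_top[of "nat \<bar>x (Suc k)\<bar>"] eventually_gt_at_top[of 0]
    by eventually_elim auto
  from v IH large show ?case
  proof eventually_elim
    case (elim l)
    define g where "g c = nat (int l + c)" for c
    define E where "E = {\<omega> \<in> space (M l). \<forall>i\<le>k. Y_proc q (2 * l) (X l) (s i) \<omega> = x i}"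
    define u where "u = (restricted_step {- int R..int R} (two_step q l) ^^ m l) (indicator {x (Suc k)}) (x k)"
    have past: "past_event (M l) (X l) (2 * rescaled_time q l (s k)) E"
      unfolding past_event_def
    proof (intro conjI ballI impI)
      fix \<omega> \<omega>' assume *: "\<omega> \<in> E" "\<omega>' \<in> space (M l)"
        "\<forall>i\<le>2 * rescaled_time q l (s k). X l i \<omega>' = X l i \<omega>"
      have "Y_proc q (2 * l) (X l) (s i) \<omega>' = Y_proc q (2 * l) (X l) (s i) \<omega>" if "i \<le> k" for i
        using *(3) le[OF that, of l] by (simp add: Y_proc_def rescaled_time_def time_scale_def)
      then show "\<omega>' \<in> E" using * by (simp add: E_def)
    qed (auto simp: E_def)
    have E_k: "{\<omega> \<in> E. X l (2 * rescaled_time q l (s k)) \<omega> = g (x k)} = E"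
      using R elim unfolding E_def g_def by (auto simp flip: Y_proc_eq_iff)
    have E_Suc: "{\<omega> \<in> E. X l (2 * rescaled_time q l (s k)) \<omega> = g (x k) \<and>
        X l (2 * rescaled_time q l (s k) + 2 * m l) \<omega> = g (x (Suc k))}
      = {\<omega> \<in> space (M l). \<forall>i\<le>Suc k. Y_proc q (2 * l) (X l) (s i) \<omega> = x i}"
    proof -
      have "2 * rescaled_time q l (s k) + 2 * m l = 2 * rescaled_time q l (s (Suc k))"
        using le[of k "Suc k" l] by (simp add: m_def)
      then have "{\<omega> \<in> E. X l (2 * rescaled_time q l (s k)) \<omega> = g (x k) \<and>
        X l (2 * rescaled_time q l (s k) + 2 * m l) \<omega> = g (x (Suc k))}
        = {\<omega> \<in> E. Y_proc q (2 * l) (X l) (s k) \<omega> = x k \<and> Y_proc q (2 * l) (X l) (s (Suc k)) \<omega> = x (Suc k)}"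
        using R elim unfolding g_def by (auto simp: Y_proc_eq_iff)
      then show ?thesis by (auto simp: E_def le_Suc_eq)
    qed
    have "measure (M l) E * u = measure (M l) {\<omega> \<in> E. X l (2 * rescaled_time q l (s k)) \<omega> = g (x k)} * u"
      by (simp only: E_k)
    also have "\<dots>
      \<le> measure (M l) {\<omega> \<in> space (M l). \<forall>i\<le>Suc k. Y_proc q (2 * l) (X l) (s i) \<omega> = x i}"
      unfolding E_Suc[symmetric] u_def
    proof (rule markov_iterate_lower_bound[OF X _ _ _ _ _ _ past])
      show "inj_on g {- int R..int R}" "g ` {- int R..int R} \<subseteq> {0..2 * l}"
        using elim by (auto simp: g_def inj_on_def)
    qed (use elim R two_step_nonneg[OF q] in \<open>auto simp: two_step_def g_def atLeast0AtMost\<close>)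
    finally have "measure (M l) E * u
      \<le> measure (M l) {\<omega> \<in> space (M l). \<forall>i\<le>Suc k. Y_proc q (2 * l) (X l) (s i) \<omega> = x i}" .
    moreover have "measure N F * \<pi> - 2 * (\<epsilon> / 2) \<le> measure (M l) E * u"
    proof (rule product_lower_bound)
      show "0 \<le> u" unfolding u_def
        by (rule restricted_step_funpow_nonneg) (use R two_step_nonneg[OF q] in auto)
    qed (use elim \<pi> Suc.prems in \<open>auto simp: E_def u_def\<close>)
    ultimately show ?case by (simp add: F_Suc)
  qed
qed

section \<open>Convergence of the joint laws\<close>

lemma measurable_map_list:
  fixes V :: "real \<Rightarrow> 'a \<Rightarrow> 's::countable"
  assumes "\<forall>t\<in>set ts. V t \<in> measurable M (count_space UNIV)"
  shows "(\<lambda>\<omega>. map (\<lambda>t. V t \<omega>) ts) \<in> measurable M (count_space UNIV)"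
proof -
  have "{\<omega> \<in> space M. map (\<lambda>t. V t \<omega>) ts = xs} \<in> sets M" for xs
    using assms
  proof (induction ts arbitrary: xs)
    case (Cons t ts)
    show ?case
    proof (cases xs)
      case (Cons y ys)
      have "V t -` {y} \<inter> space M \<in> sets M"
        using Cons.prems by (intro measurable_sets[of _ _ "count_space UNIV"]) auto
      moreover have "{\<omega> \<in> space M. map (\<lambda>t. V t \<omega>) ts = ys} \<in> sets M"
        using Cons.IH Cons.prems by simp
      ultimately have "(V t -` {y} \<inter> space M) \<inter> {\<omega> \<in> space M. map (\<lambda>t. V t \<omega>) ts = ys} \<in> sets M"
        by (rule sets.Int)
      also have "(V t -` {y} \<inter> space M) \<inter> {\<omega> \<in> space M. map (\<lambda>t. V t \<omega>) ts = ys}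
          = {\<omega> \<in> space M. map (\<lambda>t. V t \<omega>) (t # ts) = xs}"
        using Cons by auto
      finally show ?thesis .
    qed simp
  qed simp
  moreover have "(\<lambda>\<omega>. map (\<lambda>t. V t \<omega>) ts) -` {xs} \<inter> space M = {\<omega> \<in> space M. map (\<lambda>t. V t \<omega>) ts = xs}" for xs
    by auto
  ultimately show ?thesis by (simp add: measurable_count_space_eq2_countable)
qed

lemma joint_law_singleton:
  assumes "\<forall>t\<in>set ts. V t \<in> measurable M (count_space UNIV)"
  shows "measure (joint_law M V ts) {xs} = measure M {\<omega> \<in> space M. map (\<lambda>t. V t \<omega>) ts = xs}"
  unfolding joint_law_def
  by (subst measure_distr[OF measurable_map_list[OF assms]]) (auto intro!: arg_cong[of _ _ "measure M"])

lemma measurable_Y_proc: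
  assumes "markov_chain M {0..n} P X"
  shows "Y_proc q n X t \<in> measurable M (count_space UNIV)"
proof -
  have "X i \<in> measurable M (count_space {0..n})" for i
    using assms by (simp add: markov_chain_def)
  from measurable_compose[OF this, of "\<lambda>d. int d - int (n div 2)" "count_space UNIV"]
  show ?thesis unfolding Y_proc_def by simp
qed

text \<open>Prepending the starting time turns the value at time 0 into an ordinary constraint on the path.\<close>

lemma path_iff_map:
  assumes "length xs = length ts"
  shows "(\<forall>i\<le>length ts. V ((t # ts) ! i) = (x # xs) ! i) \<longleftrightarrow> V t = x \<and> map V ts = xs"
proof -
  have "(\<forall>i\<le>length ts. V ((t # ts) ! i) = (x # xs) ! i) \<longleftrightarrow> map V (t # ts) = x # xs"
    unfolding list_eq_iff_nth_eq using assms by (auto simp: less_Suc_eq_le simp del: list.map)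
  then show ?thesis by simp
qed

theorem corollary3:
  fixes q :: nat
    and M :: "nat \<Rightarrow> 'a measure" and X :: "nat \<Rightarrow> nat \<Rightarrow> 'a \<Rightarrow> nat"
    and N :: "'b measure" and Z :: "real \<Rightarrow> 'b \<Rightarrow> int"
    and z0 :: int and ts :: "real list"
  assumes q: "primepow q"
    and X: "\<And>n. even n \<Longrightarrow> n > 0 \<Longrightarrow> markov_chain (M n) {0..n} (P_mat q n) (X n)"
    and Z: "ct_markov_chain N (Q_Z q) Z"
    and ts: "sorted_wrt (<) ts" "\<forall>t\<in>set ts. 0 < t"
    and Z0: "AE \<omega> in N. Z 0 \<omega> = z0"
    and Y0: "\<forall>\<^sub>F n in sequentially. even n \<longrightarrow> (AE \<omega> in M n. Y_proc q n (X n) 0 \<omega> = z0)"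
  shows "((\<lambda>n. tv_dist (joint_law (M n) (Y_proc q n (X n)) ts) (joint_law N Z ts)) \<longlongrightarrow> 0)
           (inf sequentially (principal {n. even n}))"
proof -
  have q2: "2 \<le> q" using primepow_gt_Suc_0[OF q] by simp
  interpret N: prob_space N using Z by (simp add: ct_markov_chain_def)
  have X2: "markov_chain (M (2 * l)) {0..2 * l} (P_mat q (2 * l)) (X (2 * l))" if "0 < l" for l
    using X[of "2 * l"] that by simp
  have Y0': "\<forall>\<^sub>F l in sequentially. AE \<omega> in M (2 * l). Y_proc q (2 * l) (X (2 * l)) 0 \<omega> = z0"
  proof -
    have "filterlim (\<lambda>l :: nat. 2 * l) sequentially sequentially"
      by (rule filterlim_subseq) (auto simp: strict_mono_def)
    from eventually_compose_filterlim[OF Y0 this] show ?thesis by simp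
  qed
  have Zm: "\<forall>t\<in>set ts. Z t \<in> measurable N (count_space UNIV)"
    using Z ts(2) by (auto simp: ct_markov_chain_def less_imp_le)
  have "(\<lambda>l. tv_dist (joint_law (M (2 * l)) (Y_proc q (2 * l) (X (2 * l))) ts) (joint_law N Z ts)) \<longlonglongrightarrow> 0"
  proof (rule tv_dist_tendsto_zero)
    show "prob_space (joint_law N Z ts)"
      unfolding joint_law_def by (rule N.prob_space_distr[OF measurable_map_list[OF Zm]])
    show "\<forall>\<^sub>F l in sequentially. prob_space (joint_law (M (2 * l)) (Y_proc q (2 * l) (X (2 * l))) ts)"
      using eventually_gt_at_top[of 0]
    proof eventually_elim
      case (elim l)
      interpret prob_space "M (2 * l)" using X2[OF elim] by (simp add: markov_chain_def)
      show ?case unfolding joint_law_def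
        by (rule prob_space_distr[OF measurable_map_list]) (use measurable_Y_proc[OF X2[OF elim]] in auto)
    qed
    fix xs :: "int list" and \<epsilon> :: real assume \<epsilon>: "0 < \<epsilon>"
    define s where "s i = (0 # ts) ! i" for i
    define x where "x i = (z0 # xs) ! i" for i
    have s: "s 0 = 0" "\<forall>i<length ts. s i < s (Suc i)"
      using sorted_wrt_nth_less[of "(<)" "0 # ts" i "Suc i" for i] ts by (auto simp: s_def)
    show "\<forall>\<^sub>F l in sequentially. measure (joint_law N Z ts) {xs} - \<epsilon>
      \<le> measure (joint_law (M (2 * l)) (Y_proc q (2 * l) (X (2 * l))) ts) {xs}"
    proof (cases "length xs = length ts")
      case False
      then have "{\<omega> \<in> space N. map (\<lambda>t. Z t \<omega>) ts = xs} = {}" by auto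
      then have "measure (joint_law N Z ts) {xs} = 0"
        unfolding joint_law_singleton[OF Zm] by (simp only: measure_empty)
      then show ?thesis using \<epsilon>
        by (intro always_eventually allI order_trans[OF _ measure_nonneg]) simp
    next
      case True
      have path: "(\<forall>i\<le>length ts. V (s i) = x i) \<longleftrightarrow> V 0 = z0 \<and> map V ts = xs" for V
        using path_iff_map[OF True, of V 0 z0] by (simp add: s_def x_def)
      have Z0_sets: "{\<omega> \<in> space N. map (\<lambda>t. Z t \<omega>) ts = xs} \<in> sets N"
        using measurable_sets[OF measurable_map_list[OF Zm], of "{xs}"]
        by (simp add: vimage_def Int_def conj_commute)
      have "Z 0 -` {z0} \<inter> space N \<in> sets N"
        using Z by (intro measurable_sets[of _ _ "count_space UNIV"]) (auto simp: ct_markov_chain_def)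
      with Z0_sets have "{\<omega> \<in> space N. map (\<lambda>t. Z t \<omega>) ts = xs} \<inter> (Z 0 -` {z0} \<inter> space N) \<in> sets N"
        by (rule sets.Int)
      also have "{\<omega> \<in> space N. map (\<lambda>t. Z t \<omega>) ts = xs} \<inter> (Z 0 -` {z0} \<inter> space N)
          = {\<omega> \<in> space N. Z 0 \<omega> = z0 \<and> map (\<lambda>t. Z t \<omega>) ts = xs}" by auto
      finally have path_sets: "{\<omega> \<in> space N. Z 0 \<omega> = z0 \<and> map (\<lambda>t. Z t \<omega>) ts = xs} \<in> sets N" .
      have Z_path: "measure (joint_law N Z ts) {xs} = measure N {\<omega> \<in> space N. \<forall>i\<le>length ts. Z (s i) \<omega> = x i}"
        unfolding joint_law_singleton[OF Zm] path[of "\<lambda>t. Z t _"]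
        by (rule measure_eq_AE[OF _ Z0_sets path_sets]) (use Z0 in auto)
      have "\<forall>\<^sub>F l in sequentially. measure N {\<omega> \<in> space N. \<forall>i\<le>length ts. Z (s i) \<omega> = x i} - \<epsilon>
        \<le> measure (M (2 * l)) {\<omega> \<in> space (M (2 * l)). \<forall>i\<le>length ts. Y_proc q (2 * l) (X (2 * l)) (s i) \<omega> = x i}"
        by (rule path_probability_lower_limit[OF q2 X2 Z Z0 Y0' s \<epsilon>])
      with eventually_gt_at_top[of 0] show ?thesis
      proof eventually_elim
        case (elim l)
        interpret prob_space "M (2 * l)" using X2[OF elim(1)] by (simp add: markov_chain_def)
        have Ym: "\<forall>t\<in>set ts. Y_proc q (2 * l) (X (2 * l)) t \<in> measurable (M (2 * l)) (count_space UNIV)"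
          using measurable_Y_proc[OF X2[OF elim(1)]] by blast
        have "measure (M (2 * l)) {\<omega> \<in> space (M (2 * l)). \<forall>i\<le>length ts. Y_proc q (2 * l) (X (2 * l)) (s i) \<omega> = x i}
          \<le> measure (joint_law (M (2 * l)) (Y_proc q (2 * l) (X (2 * l))) ts) {xs}"
          unfolding joint_law_singleton[OF Ym] path[of "\<lambda>t. Y_proc q (2 * l) (X (2 * l)) t _"]
        proof (rule finite_measure_mono)
          show "{\<omega> \<in> space (M (2 * l)). map (\<lambda>t. Y_proc q (2 * l) (X (2 * l)) t \<omega>) ts = xs} \<in> events"
            using measurable_sets[OF measurable_map_list[OF Ym], of "{xs}"]
            by (simp add: vimage_def Int_def conj_commute)
        qed auto
        with elim(2) show ?case by (simp add: Z_path)
      qed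
    qed
  qed (simp_all add: joint_law_def)
  then show ?thesis
    unfolding tendsto_iff eventually_inf_principal eventually_sequentially
    by (metis (no_types, lifting) evenE mem_Collect_eq mult_le_cancel1 zero_less_numeral)
qed

end
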